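(* Let $k$ be an infinite field of arbitrary characteristic, let $I$ be an arbitrary proper homogeneous ideal in $R=k[x_1,\ldots,x_n]$, and let $s\ge\dim R/I$ be an integer. Then $$r_s(R/I)\le r_s(R/I^{lex}).$$
   Context: A lex-segment ideal is a monomial ideal $J$ of $R$ such that if a monomial $x^A$ is in $J$, then $x^B\in J$ for every monomial $x^B$ of the same degree with $x^B\ge x^A$ in the lexicographic order (with $x_1>x_2>\cdots>x_n$). For a homogeneous ideal $I$, $I^{lex}$ denotes the unique lex-segment ideal whose Hilbert function equals that of $I$. Let $A$ be a standard graded algebra over $k$. An ideal $\mathfrak q=(z_1,\ldots,z_s)$ generated by linear forms $z_1,\ldots,z_s$ of $A$ is called an $s$-reduction of $A$ if $\mathfrak q_t=A_t$ for all $t$ large enough. The reduction number $r_{\mathfrak q}(A)$ is the minimum integer $r\ge 0$ such that $\mathfrak q_{r+1}=A_{r+1}$. The $s$-reduction number of $A$ is $r_s(A)=\min\{r_{\mathfrak q}(A)\mid \mathfrak q=(z_1,\ldots,z_s)\text{ is an } s\text{-reduction of }A\}$. *)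

theory Defs
  imports
    "HOL-Algebra.QuotRing"
    "HOL-Library.Poly_Mapping"
    "HOL-Library.Extended_Nat"
begin

text \<open>
  An exponent vector is a finitely supported function \<open>nat \<Rightarrow>\<^sub>0 nat\<close>, and a polynomial is a
  finitely supported function from exponent vectors to the coefficient field.  The \<open>n\<close> variables
  \<open>x\<^sub>1, \<dots>, x\<^sub>n\<close> are indexed by \<open>0, \<dots>, n - 1\<close>.
\<close>

type_synonym expo = "nat \<Rightarrow>\<^sub>0 nat"
type_synonym 'k mpoly = "expo \<Rightarrow>\<^sub>0 'k"

definition expos :: "nat \<Rightarrow> expo set" where
  "expos n = {a. Poly_Mapping.keys a \<subseteq> {..<n}}"

definition expo_deg :: "expo \<Rightarrow> nat" where
  "expo_deg a = (\<Sum>i\<in>Poly_Mapping.keys a. Poly_Mapping.lookup a i)"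

definition monomial :: "expo \<Rightarrow> 'k::field mpoly" where
  "monomial a = Poly_Mapping.single a 1"

definition mpoly_ring :: "nat \<Rightarrow> 'k::field mpoly ring" where
  "mpoly_ring n =
    \<lparr>carrier = {p. Poly_Mapping.keys p \<subseteq> expos n}, mult = (*), one = 1, zero = 0, add = (+)\<rparr>"

definition forms :: "nat \<Rightarrow> nat \<Rightarrow> 'k::field mpoly set" where
  "forms n t = {p \<in> carrier (mpoly_ring n). \<forall>a\<in>Poly_Mapping.keys p. expo_deg a = t}"

text \<open>Scalar multiplication by \<open>c\<close> is multiplication by the constant polynomial \<open>c\<close>.\<close>

definition mpoly_scale :: "'k::field \<Rightarrow> 'k mpoly \<Rightarrow> 'k mpoly" where
  "mpoly_scale c p = Poly_Mapping.single 0 c * p"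

definition homogeneous_ideal :: "nat \<Rightarrow> 'k::field mpoly set \<Rightarrow> bool" where
  "homogeneous_ideal n I \<longleftrightarrow> (\<exists>S \<subseteq> (\<Union>t. forms n t). I = genideal (mpoly_ring n) S)"

definition monomial_ideal :: "nat \<Rightarrow> 'k::field mpoly set \<Rightarrow> bool" where
  "monomial_ideal n J \<longleftrightarrow> (\<exists>E \<subseteq> expos n. J = genideal (mpoly_ring n) (monomial ` E))"

definition hilbert_function :: "nat \<Rightarrow> 'k::field mpoly set \<Rightarrow> nat \<Rightarrow> nat" where
  "hilbert_function n I t = vector_space.dim mpoly_scale (I \<inter> forms n t)"

text \<open>
  The library order on \<open>nat \<Rightarrow>\<^sub>0 nat\<close> compares two exponent vectors at the least index where they
  differ, so it is the lexicographic order with \<open>x\<^sub>1 > x\<^sub>2 > \<dots> > x\<^sub>n\<close>; see \<open>expo_less_iff\<close> below.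
\<close>

definition lex_segment_ideal :: "nat \<Rightarrow> 'k::field mpoly set \<Rightarrow> bool" where
  "lex_segment_ideal n J \<longleftrightarrow>
    monomial_ideal n J \<and>
    (\<forall>a \<in> expos n. \<forall>b \<in> expos n.
      monomial a \<in> J \<and> expo_deg b = expo_deg a \<and> a \<le> b \<longrightarrow> monomial b \<in> J)"

text \<open>
  \<open>is_lex_ideal_of n J I\<close> expresses \<open>J = I\<^sup>l\<^sup>e\<^sup>x\<close>.  Such a \<open>J\<close> is unique, and it exists for every
  homogeneous \<open>I\<close> by Macaulay's theorem.
\<close>

definition is_lex_ideal_of :: "nat \<Rightarrow> 'k::field mpoly set \<Rightarrow> 'k mpoly set \<Rightarrow> bool" where
  "is_lex_ideal_of n J I \<longleftrightarrow>
    lex_segment_ideal n J \<and> (\<forall>t. hilbert_function n J t = hilbert_function n I t)"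

definition krull_dim :: "('a, 'b) ring_scheme \<Rightarrow> enat" where
  "krull_dim A = Sup {enat l | l. \<exists>P :: nat \<Rightarrow> 'a set.
     (\<forall>i\<le>l. primeideal (P i) A) \<and> (\<forall>i<l. P i \<subset> P (Suc i))}"

text \<open>
  A graded algebra is given by a ring \<open>A\<close> together with its family \<open>G\<close> of homogeneous components;
  the degree \<open>t\<close> part of an ideal \<open>\<qq>\<close> is \<open>\<qq> \<inter> G t\<close>.  The linear forms \<open>z 0, \<dots>, z (s - 1)\<close> need
  be neither distinct nor nonzero.
\<close>

definition s_reduction ::
  "('a, 'b) ring_scheme \<Rightarrow> (nat \<Rightarrow> 'a set) \<Rightarrow> nat \<Rightarrow> 'a set \<Rightarrow> bool" where
  "s_reduction A G s \<qq> \<longleftrightarrow>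
    (\<exists>z. (\<forall>i<s. z i \<in> G 1) \<and> \<qq> = genideal A (z ` {..<s})) \<and>
    (\<exists>t0. \<forall>t\<ge>t0. \<qq> \<inter> G t = G t)"

definition reduction_number_of :: "(nat \<Rightarrow> 'a set) \<Rightarrow> 'a set \<Rightarrow> nat" where
  "reduction_number_of G \<qq> = (LEAST r. \<qq> \<inter> G (r + 1) = G (r + 1))"

definition s_reduction_number ::
  "('a, 'b) ring_scheme \<Rightarrow> (nat \<Rightarrow> 'a set) \<Rightarrow> nat \<Rightarrow> nat" where
  "s_reduction_number A G s =
    (LEAST r. \<exists>\<qq>. s_reduction A G s \<qq> \<and> r = reduction_number_of G \<qq>)"

text \<open>The components of \<open>R/I\<close> are the images of those of \<open>R = k[x\<^sub>1, \<dots>, x\<^sub>n]\<close>.\<close>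

definition quot_forms :: "nat \<Rightarrow> 'k::field mpoly set \<Rightarrow> nat \<Rightarrow> 'k mpoly set set" where
  "quot_forms n I t = (\<lambda>f. I +>\<^bsub>mpoly_ring n\<^esub> f) ` forms n t"

lemma expo_less_iff:
  fixes a b :: expo
  shows "a < b \<longleftrightarrow>
    (\<exists>i. Poly_Mapping.lookup a i < Poly_Mapping.lookup b i \<and>
      (\<forall>j<i. Poly_Mapping.lookup a j = Poly_Mapping.lookup b j))"
  by (simp add: less_poly_mapping.rep_eq less_fun_def)

lemma vector_space_mpoly: "vector_space (mpoly_scale :: 'k::field \<Rightarrow> 'k mpoly \<Rightarrow> 'k mpoly)"
  by unfold_locales
    (simp_all add: mpoly_scale_def distrib_left distrib_right single_add mult_single
      flip: mult.assoc)

lemma expos_add: "a \<in> expos n \<Longrightarrow> b \<in> expos n \<Longrightarrow> a + b \<in> expos n"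
  unfolding expos_def using Poly_Mapping.keys_add[of a b] by blast

lemma cring_mpoly_ring: "cring (mpoly_ring n :: 'k::field mpoly ring)"
proof (rule cringI)
  show "abelian_group (mpoly_ring n :: 'k mpoly ring)"
  proof (rule abelian_groupI)
    fix p q :: "'k mpoly"
    assume "p \<in> carrier (mpoly_ring n)" "q \<in> carrier (mpoly_ring n)"
    then show "p \<oplus>\<^bsub>mpoly_ring n\<^esub> q \<in> carrier (mpoly_ring n)"
      using Poly_Mapping.keys_add[of p q] by (auto simp: mpoly_ring_def)
  next
    fix p :: "'k mpoly" assume "p \<in> carrier (mpoly_ring n)"
    then show "\<exists>q\<in>carrier (mpoly_ring n). q \<oplus>\<^bsub>mpoly_ring n\<^esub> p = \<zero>\<^bsub>mpoly_ring n\<^esub>"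
      by (intro bexI[of _ "- p"]) (auto simp: mpoly_ring_def)
  qed (auto simp: mpoly_ring_def ac_simps)
  show "comm_monoid (mpoly_ring n :: 'k mpoly ring)"
  proof (rule comm_monoidI)
    fix p q :: "'k mpoly"
    assume "p \<in> carrier (mpoly_ring n)" "q \<in> carrier (mpoly_ring n)"
    then show "p \<otimes>\<^bsub>mpoly_ring n\<^esub> q \<in> carrier (mpoly_ring n)"
      using Poly_Mapping.keys_mult[of p q] expos_add by (fastforce simp: mpoly_ring_def)
  qed (auto simp: mpoly_ring_def expos_def ac_simps)
qed (auto simp: mpoly_ring_def distrib_right)

end

theory Submission
  imports Defs "Jordan_Normal_Form.Char_Poly"
begin

text \<open>
  Let \<open>H\<^sub>I\<close> be the Hilbert function of \<open>R/I\<close>, and call \<open>I\<close> \<^emph>\<open>reducible\<close> in degree \<open>t\<close> if \<open>s\<close> linear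
  forms generate \<open>R/I\<close> in degree \<open>t\<close>.  The reduction number \<open>r\<^sub>s(R/I)\<close> is then the least \<open>r\<close> such that \<open>I\<close> is
  reducible in degree \<open>r + 1\<close>.  Let \<open>M(t)\<close> be the number of monomials of degree \<open>t\<close> in \<open>s + 1\<close>
  variables.  The idea is that \<open>H\<^sub>I(t) < M(t)\<close> always implies reducibility in degree \<open>t\<close>, and that it is
  equivalent to reducibility for lex-segment ideals if \<open>s < n\<close>.  (If \<open>s \<ge> n\<close>, then the variables are
  among \<open>s\<close> linear forms and \<open>r\<^sub>s(R/I) = 0\<close>.)  As \<open>I\<close> and \<open>J = I\<^sup>l\<^sup>e\<^sup>x\<close> have the same Hilbert function, \<open>I\<close> is
  then reducible in every degree in which \<open>J\<close> is.

  The implication is the theorem of Eakin and Sathaye (\<open>eakin_sathaye\<close>).  It rests on the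
  existence of linear forms which are good for several ideals at once over an infinite field
  (\<open>common_reduction\<close>).  For this it is enough that being good is an open condition along lines, which
  comes down to the finiteness of the set of eigenvalues of a matrix.

  For the equivalence (\<open>lex_segment_reducible_imp_large\<close>) put \<open>j = n - s - 1\<close>.  A lex-segment ideal with
  \<open>H\<^sub>J(t) \<ge> M(t)\<close> does not contain \<open>x\<^sub>j\<^sup>t\<close>, so that all its monomials of degree \<open>t\<close> involve one of the
  first \<open>j\<close> variables.  But the ideal of these variables is not reducible in any degree, by a count
  of monomials: an ideal that is reducible in some degree satisfies \<open>H(u) < M(u)\<close> for some large \<open>u\<close>
  (\<open>reducible_imp_hilbert_function_large\<close>).

  It remains to see that \<open>J\<close> is reducible in some degree at all.  By the last
  count and the theorem of Eakin and Sathaye, this follows if \<open>I\<close> is reducible in some degree.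
  Otherwise there would be a strictly increasing chain of \<open>s + 2\<close> prime ideals above \<open>I\<close>
  (\<open>irreducible_imp_prime_chain\<close>), contrary to \<open>dim R/I \<le> s\<close>: a homogeneous ideal that is maximal among
  those which are reducible in no degree is prime, by genericity once more.
\<close>

section \<open>Polynomials, forms and graded ideals\<close>

abbreviation polys :: "nat \<Rightarrow> 'k::field mpoly set" where
  "polys n \<equiv> carrier (mpoly_ring n)"

interpretation mp: vector_space "mpoly_scale :: 'k::field \<Rightarrow> 'k mpoly \<Rightarrow> 'k mpoly"
  by (rule vector_space_mpoly)

lemma ring_mpoly_ring: "ring (mpoly_ring n :: 'k::field mpoly ring)"
  using cring_mpoly_ring by (rule cring.axioms)

lemma mpoly_ring_simps [simp]:
  "monoid.mult (mpoly_ring n) = (*)" "monoid.one (mpoly_ring n) = 1" "ring.zero (mpoly_ring n) = 0"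
  "ring.add (mpoly_ring n) = (+)"
  by (simp_all add: mpoly_ring_def)

lemma polys_iff: "p \<in> polys n \<longleftrightarrow> Poly_Mapping.keys p \<subseteq> expos n"
  by (simp add: mpoly_ring_def)

lemma polys_0 [simp]: "0 \<in> polys n"
  and polys_1 [simp]: "1 \<in> polys n"
  and polys_single: "a \<in> expos n \<Longrightarrow> Poly_Mapping.single a c \<in> polys n"
  and polys_monomial: "a \<in> expos n \<Longrightarrow> monomial a \<in> polys n"
  by (auto simp: polys_iff expos_def monomial_def)

lemma polys_add: "p \<in> polys n \<Longrightarrow> q \<in> polys n \<Longrightarrow> p + q \<in> polys n"
  and polys_mult: "p \<in> polys n \<Longrightarrow> q \<in> polys n \<Longrightarrow> p * q \<in> polys n"
  for p q :: "'k::field mpoly"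
proof -
  interpret cring "mpoly_ring n :: 'k mpoly ring" by (rule cring_mpoly_ring)
  show "p \<in> polys n \<Longrightarrow> q \<in> polys n \<Longrightarrow> p + q \<in> polys n"
    and "p \<in> polys n \<Longrightarrow> q \<in> polys n \<Longrightarrow> p * q \<in> polys n"
    using a_closed m_closed by (simp_all only: mpoly_ring_simps)
qed

lemma zero_expos [simp]: "0 \<in> expos n"
  by (simp add: expos_def)

lemma polys_scale: "p \<in> polys n \<Longrightarrow> mpoly_scale c p \<in> polys n"
  by (simp add: mpoly_scale_def polys_mult polys_single)

lemma polys_sum: "(\<And>i. i \<in> A \<Longrightarrow> f i \<in> polys n) \<Longrightarrow> sum f A \<in> polys n"
  by (induction A rule: infinite_finite_induct) (auto simp: polys_add)

lemma lookup_mpoly_scale [simp]: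
  "Poly_Mapping.lookup (mpoly_scale c p) a = c * Poly_Mapping.lookup p a"
proof -
  have "mpoly_scale c p = Poly_Mapping.map ((*) c) p"
    by (simp add: mpoly_scale_def mult_map_scale_conv_mult)
  then show ?thesis
    by (simp add: Poly_Mapping.map.rep_eq when_def)
qed

lemma scale_mult_left: "mpoly_scale c p * q = mpoly_scale c (p * q)"
  and scale_mult_right: "p * mpoly_scale c q = mpoly_scale c (p * q)"
  by (simp_all add: mpoly_scale_def mult_ac)

lemma lookup_monomial: "Poly_Mapping.lookup (monomial a :: 'k::field mpoly) b = (if a = b then 1 else 0)"
  by (simp add: monomial_def lookup_single)

lemma monomial_add: "monomial (a + b) = (monomial a * monomial b :: 'k::field mpoly)"
  by (simp add: monomial_def mult_single)

lemma mpoly_expand: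
  fixes p :: "'k::field mpoly"
  assumes "finite A" "Poly_Mapping.keys p \<subseteq> A"
  shows "p = (\<Sum>a\<in>A. mpoly_scale (Poly_Mapping.lookup p a) (monomial a))"
proof (rule poly_mapping_eqI)
  fix b
  have "(\<Sum>a\<in>A. Poly_Mapping.lookup (mpoly_scale (Poly_Mapping.lookup p a) (monomial a :: 'k mpoly)) b)
      = (\<Sum>a\<in>A. if a = b then Poly_Mapping.lookup p b else 0)"
    by (intro sum.cong) (auto simp: lookup_monomial)
  also have "\<dots> = Poly_Mapping.lookup p b"
    using assms by (auto simp: in_keys_iff)
  finally show "Poly_Mapping.lookup p b = Poly_Mapping.lookup
      (\<Sum>a\<in>A. mpoly_scale (Poly_Mapping.lookup p a) (monomial a)) b"
    by (simp add: lookup_sum)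
qed

lemma expo_deg_superset:
  assumes "finite A" "Poly_Mapping.keys a \<subseteq> A"
  shows "expo_deg a = (\<Sum>i\<in>A. Poly_Mapping.lookup a i)"
  unfolding expo_deg_def using assms
  by (intro sum.mono_neutral_left) (auto simp: in_keys_iff)

lemma expo_deg_add: "expo_deg (a + b) = expo_deg a + expo_deg b"
proof -
  let ?A = "Poly_Mapping.keys a \<union> Poly_Mapping.keys b"
  have "expo_deg (a + b) = (\<Sum>i\<in>?A. Poly_Mapping.lookup (a + b) i)"
    using Poly_Mapping.keys_add[of a b] by (intro expo_deg_superset) auto
  then show ?thesis
    by (simp add: lookup_add sum.distrib expo_deg_superset[of ?A])
qed

lemma expo_deg_zero [simp]: "expo_deg 0 = 0"
  by (simp add: expo_deg_def)

lemma expo_deg_single [simp]: "expo_deg (Poly_Mapping.single i c) = c"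
  by (simp add: expo_deg_def)

lemma lookup_le_expo_deg: "Poly_Mapping.lookup a i \<le> expo_deg a"
  using member_le_sum[of i "insert i (Poly_Mapping.keys a)" "Poly_Mapping.lookup a"]
  by (simp add: expo_deg_superset[of "insert i (Poly_Mapping.keys a)"] subset_insertI)

lemma expo_deg_0_iff: "expo_deg a = 0 \<longleftrightarrow> a = 0"
  using lookup_le_expo_deg[of a] by (metis expo_deg_zero le_zero_eq lookup_zero poly_mapping_eqI)

text \<open>Arbitrary index sets \<open>S\<close> are allowed because both initial and final segments of the variables
  occur.\<close>

definition mons :: "nat set \<Rightarrow> nat \<Rightarrow> expo set" where
  "mons S t = {a. Poly_Mapping.keys a \<subseteq> S \<and> expo_deg a = t}"

lemma mons_0 [simp]: "mons S 0 = {0}"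
  by (auto simp: mons_def expo_deg_0_iff)

lemma mons_add: "a \<in> mons S t \<Longrightarrow> b \<in> mons S u \<Longrightarrow> a + b \<in> mons S (t + u)"
  unfolding mons_def using Poly_Mapping.keys_add[of a b] by (auto simp: expo_deg_add)

lemma mons_single: "i \<in> S \<Longrightarrow> Poly_Mapping.single i t \<in> mons S t"
  by (auto simp: mons_def)

lemma mons_peel:
  assumes "a \<in> mons S (Suc t)" "Poly_Mapping.lookup a i \<noteq> 0"
  obtains b where "i \<in> S" "b \<in> mons S t" "a = Poly_Mapping.single i 1 + b"
proof
  let ?b = "a - Poly_Mapping.single i 1"
  show ab: "a = Poly_Mapping.single i 1 + ?b"
    using assms(2) by (intro poly_mapping_eqI) (auto simp: lookup_add lookup_minus lookup_single when_def)
  show "i \<in> S"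
    using assms by (auto simp: mons_def in_keys_iff)
  have "expo_deg a = 1 + expo_deg ?b"
    using expo_deg_add[of "Poly_Mapping.single i 1" ?b] ab by simp
  moreover have "Poly_Mapping.keys ?b \<subseteq> Poly_Mapping.keys a"
    by (auto simp: in_keys_iff lookup_minus)
  ultimately show "?b \<in> mons S t"
    using assms(1) by (auto simp: mons_def)
qed

lemma mons_SucE:
  assumes "a \<in> mons S (Suc t)"
  obtains i b where "i \<in> S" "b \<in> mons S t" "a = Poly_Mapping.single i 1 + b"
proof -
  have "a \<noteq> 0"
    using assms by (auto simp: mons_def)
  then obtain i where "Poly_Mapping.lookup a i \<noteq> 0"
    by (metis lookup_zero poly_mapping_eqI)
  with assms show thesis
    by (rule mons_peel) (rule that)
qed

lemma mons_insert:
  assumes "i \<notin> S"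
  shows "mons (insert i S) (Suc t)
    = mons S (Suc t) \<union> (+) (Poly_Mapping.single i 1) ` mons (insert i S) t"
    and "mons S (Suc t) \<inter> (+) (Poly_Mapping.single i 1) ` mons (insert i S) t = {}"
proof -
  let ?f = "(+) (Poly_Mapping.single i (1::nat))"
  have "a \<in> mons S (Suc t) \<union> ?f ` mons (insert i S) t" if "a \<in> mons (insert i S) (Suc t)" for a
  proof (cases "Poly_Mapping.lookup a i = 0")
    case True
    then have "i \<notin> Poly_Mapping.keys a"
      by (simp add: in_keys_iff)
    with that show ?thesis by (auto simp: mons_def)
  next
    case False
    with that show ?thesis by (metis UnCI image_eqI mons_peel)
  qed
  moreover have "?f a \<in> mons (insert i S) (Suc t)" if "a \<in> mons (insert i S) t" for a
    using mons_add[OF mons_single[of i "insert i S" 1] that] by simp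
  moreover have "mons S (Suc t) \<subseteq> mons (insert i S) (Suc t)"
    by (auto simp: mons_def)
  ultimately show "mons (insert i S) (Suc t) = mons S (Suc t) \<union> ?f ` mons (insert i S) t"
    by blast
  have "?f b \<notin> mons S (Suc t)" for b
  proof
    assume "?f b \<in> mons S (Suc t)"
    moreover have "i \<in> Poly_Mapping.keys (?f b)"
      by (simp add: in_keys_iff lookup_add)
    ultimately show False
      using assms by (auto simp: mons_def)
  qed
  then show "mons S (Suc t) \<inter> ?f ` mons (insert i S) t = {}"
    by blast
qed

text \<open>The Hilbert function of a polynomial ring in \<open>m\<close> variables.  With truncated subtraction the
  formula is also right for \<open>m = 0\<close>.\<close>

definition mon_count :: "nat \<Rightarrow> nat \<Rightarrow> nat" where
  "mon_count m t = (m + t - 1) choose t"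

lemma mon_count_0 [simp]: "mon_count m 0 = 1"
  and mon_count_0_left: "mon_count 0 (Suc t) = 0"
  and mon_count_Suc:
    "mon_count (Suc m) (Suc t) = mon_count m (Suc t) + mon_count (Suc m) t"
  by (simp_all add: mon_count_def)

lemma mon_count_1 [simp]: "mon_count (Suc 0) t = 1"
  by (simp add: mon_count_def)

lemma finite_card_mons:
  assumes "finite S"
  shows "finite (mons S t) \<and> card (mons S t) = mon_count (card S) t"
  using assms
proof (induction S arbitrary: t rule: finite_induct)
  case empty
  have "mons {} (Suc t) = {}" for t
    by (auto simp: mons_def)
  then show ?case
    by (cases t) (auto simp: mon_count_0_left)
next
  case (insert i S)
  show ?case
  proof (induction t)
    case (Suc t)
    let ?f = "(+) (Poly_Mapping.single i (1::nat))"
    have "card (?f ` mons (insert i S) t) = mon_count (Suc (card S)) t"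
      using Suc insert by (subst card_image) (auto simp: inj_on_def)
    then show ?case
      unfolding mons_insert(1)[OF insert(2)]
      using Suc insert mons_insert(2)[OF insert(2), of t]
      by (subst card_Un_disjoint) (auto simp: mon_count_Suc)
  qed simp
qed

lemmas finite_mons = finite_card_mons[THEN conjunct1]
  and card_mons = finite_card_mons[THEN conjunct2]

text \<open>One more variable beats any constant factor, because
  \<open>(m + 1) * mon_count (m + 2) k = (m + 1 + k) * mon_count (m + 1) k\<close>.\<close>

lemma mon_count_dominates: "\<exists>k. c * mon_count s k < mon_count (Suc s) (d + k)"
proof (cases s)
  case 0
  then show ?thesis by (intro exI[of _ 1]) (simp add: mon_count_0_left)
next
  case (Suc m)
  define k where "k = c * (m + 1)"
  have mono: "mon_count (Suc s) k \<le> mon_count (Suc s) (d + k)" for k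
    by (induction d) (auto simp: mon_count_Suc)
  have "(m + 1) * mon_count (Suc s) k = (m + 1 + k) * mon_count s k"
  proof -
    have "mon_count s k = (m + k) choose m" "mon_count (Suc s) k = Suc (m + k) choose Suc m"
      using binomial_symmetric[of m "m + k"] binomial_symmetric[of "Suc m" "Suc (m + k)"]
      by (simp_all add: mon_count_def Suc)
    then show ?thesis
      using Suc_times_binomial_eq[of "m + k" m] by (simp add: algebra_simps)
  qed
  moreover have "mon_count s k > 0"
    by (simp add: mon_count_def Suc)
  ultimately have "(m + 1) * (c * mon_count s k) < (m + 1) * mon_count (Suc s) k"
    by (simp add: k_def algebra_simps)
  then have "c * mon_count s k < mon_count (Suc s) k"
    by (simp only: mult_less_cancel1)
  with mono[of k] show ?thesis by (auto intro!: exI[of _ k])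
qed

lemma forms_iff: "p \<in> forms n t \<longleftrightarrow> Poly_Mapping.keys p \<subseteq> mons {..<n} t"
  by (auto simp: forms_def polys_iff expos_def mons_def)

lemma forms_polys: "p \<in> forms n t \<Longrightarrow> p \<in> polys n"
  by (simp add: forms_def)

lemma mons_expos: "a \<in> mons {..<n} t \<Longrightarrow> a \<in> expos n"
  and expos_mons: "a \<in> expos n \<Longrightarrow> a \<in> mons {..<n} (expo_deg a)"
  by (auto simp: mons_def expos_def)

lemma forms_0 [simp]: "0 \<in> forms n t"
  by (simp add: forms_iff)

lemma forms_monomial: "a \<in> mons {..<n} t \<Longrightarrow> monomial a \<in> forms n t"
  by (simp add: forms_iff monomial_def)

lemma forms_add: "p \<in> forms n t \<Longrightarrow> q \<in> forms n t \<Longrightarrow> p + q \<in> forms n t"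
  unfolding forms_iff using Poly_Mapping.keys_add[of p q] by blast

lemma forms_mult:
  fixes p q :: "'k::field mpoly"
  assumes "p \<in> forms n t" "q \<in> forms n u"
  shows "p * q \<in> forms n (t + u)"
  unfolding forms_iff using Poly_Mapping.keys_mult[of p q] assms mons_add
  by (fastforce simp: forms_iff)

lemma forms_scale: "p \<in> forms n t \<Longrightarrow> mpoly_scale c p \<in> forms n t"
  by (auto simp: forms_iff subset_iff in_keys_iff)

lemma forms_sum: "(\<And>i. i \<in> A \<Longrightarrow> f i \<in> forms n t) \<Longrightarrow> sum f A \<in> forms n t"
  by (induction A rule: infinite_finite_induct) (auto simp: forms_add)

lemma forms_expand:
  fixes p :: "'k::field mpoly"
  assumes "p \<in> forms n t"
  shows "p = (\<Sum>a\<in>mons {..<n} t. mpoly_scale (Poly_Mapping.lookup p a) (monomial a))"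
  using assms by (intro mpoly_expand) (auto simp: finite_mons forms_iff)

definition part :: "nat \<Rightarrow> 'k::field mpoly \<Rightarrow> 'k mpoly" where
  "part t = Poly_Mapping.mapp (\<lambda>a c. c when expo_deg a = t)"

lemma lookup_part:
  "Poly_Mapping.lookup (part t p) a = (if expo_deg a = t then Poly_Mapping.lookup p a else 0)"
  by (auto simp: part_def lookup_mapp when_def in_keys_iff)

lemma part_add: "part t (p + q) = part t p + part t q"
  and part_0 [simp]: "part t 0 = 0"
  by (auto intro!: poly_mapping_eqI simp: lookup_part lookup_add)

lemma part_sum: "part t (sum f A) = (\<Sum>i\<in>A. part t (f i))"
  by (induction A rule: infinite_finite_induct) (auto simp: part_add)

lemma part_in_forms: "p \<in> polys n \<Longrightarrow> part t p \<in> forms n t"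
  by (auto simp: forms_iff polys_iff subset_iff mons_def expos_def in_keys_iff lookup_part split: if_splits)

lemma part_forms: "p \<in> forms n t \<Longrightarrow> part u p = (if u = t then p else 0)"
  by (auto intro!: poly_mapping_eqI simp: lookup_part forms_def in_keys_iff)

lemma part_polys: "p \<in> polys n \<Longrightarrow> part t p \<in> polys n"
  by (blast intro: part_in_forms forms_polys)

lemma part_mult_form:
  fixes p q :: "'k::field mpoly"
  assumes p: "p \<in> forms n d" and q: "q \<in> polys n"
  shows "part (d + t) (p * q) = p * part t q"
    and "u < d \<Longrightarrow> part u (p * q) = 0"
proof -
  have dec: "Poly_Mapping.keys (p * r) \<subseteq> {a. \<exists>b\<in>Poly_Mapping.keys r. expo_deg a = d + expo_deg b}" for r
    using Poly_Mapping.keys_mult[of p r] p by (fastforce simp: forms_def expo_deg_add)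
  show "part (d + t) (p * q) = p * part t q"
  proof (rule poly_mapping_eqI)
    fix a
    have "Poly_Mapping.lookup (p * (q - part t q)) a = 0" if "expo_deg a = d + t"
      using dec[of "q - part t q"] that
      by (fastforce simp: in_keys_iff lookup_minus lookup_part)
    moreover have "Poly_Mapping.lookup (p * part t q) a = 0" if "expo_deg a \<noteq> d + t"
      using dec[of "part t q"] that by (fastforce simp: in_keys_iff lookup_part)
    moreover have "p * q = p * part t q + p * (q - part t q)"
      by (simp add: algebra_simps)
    ultimately show "Poly_Mapping.lookup (part (d + t) (p * q)) a = Poly_Mapping.lookup (p * part t q) a"
      by (simp add: lookup_part lookup_add)
  qed
  show "part u (p * q) = 0" if "u < d"
    using dec[of q] that by (intro poly_mapping_eqI) (fastforce simp: in_keys_iff lookup_part)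
qed

lemma sum_parts:
  fixes p :: "'k::field mpoly"
  assumes "\<And>a. a \<in> Poly_Mapping.keys p \<Longrightarrow> expo_deg a \<le> N"
  shows "p = (\<Sum>t\<le>N. part t p)"
proof (rule poly_mapping_eqI)
  fix a
  have "Poly_Mapping.lookup p a = 0" if "\<not> expo_deg a \<le> N"
    using assms that by (auto simp: in_keys_iff)
  then show "Poly_Mapping.lookup p a = Poly_Mapping.lookup (\<Sum>t\<le>N. part t p) a"
    by (auto simp: lookup_sum lookup_part)
qed

lemma ideal_mpoly_iff:
  fixes I :: "'k::field mpoly set"
  shows "ideal I (mpoly_ring n) \<longleftrightarrow> I \<subseteq> polys n \<and> 0 \<in> I \<and> (\<forall>p\<in>I. \<forall>q\<in>I. p + q \<in> I) \<and>
    (\<forall>p\<in>I. \<forall>r\<in>polys n. r * p \<in> I)" (is "_ \<longleftrightarrow> ?R")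
proof
  interpret R: cring "mpoly_ring n :: 'k mpoly ring" by (rule cring_mpoly_ring)
  assume "ideal I (mpoly_ring n)"
  then interpret ideal I "mpoly_ring n" .
  show ?R
    using a_subset zero_closed a_closed I_l_closed by auto
next
  interpret R: cring "mpoly_ring n :: 'k mpoly ring" by (rule cring_mpoly_ring)
  assume R: ?R
  have "- p \<in> I" if "p \<in> I" for p
  proof -
    have "Poly_Mapping.single 0 (- 1) * p \<in> I"
      using R that polys_single[of 0 n "- 1 :: 'k"] by simp
    moreover have "Poly_Mapping.single 0 (- 1) * p = - p"
      by (simp add: single_uminus)
    ultimately show ?thesis by simp
  qed
  then have inv: "\<exists>q\<in>I. p + q = 0" if "p \<in> I" for p
    using that by (auto intro!: bexI[of _ "- p"])
  show "ideal I (mpoly_ring n)"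
  proof (rule idealI[OF ring_mpoly_ring])
    have "\<ominus>\<^bsub>mpoly_ring n\<^esub> p \<in> I" if p: "p \<in> I" for p
    proof -
      obtain q where q: "q \<in> I" "p + q = 0" using inv p by blast
      then have "\<ominus>\<^bsub>mpoly_ring n\<^esub> p = q"
        using R p R.minus_equality[of q p] by (auto simp: add.commute)
      then show ?thesis using q by simp
    qed
    then show "subgroup I (add_monoid (mpoly_ring n))"
      using R by (intro R.add.subgroupI) (auto simp: a_inv_def)
  qed (use R in \<open>auto simp: mult.commute\<close>)
qed

text \<open>Homogeneity is expressed by parts of elements rather than by generating forms because in this
  shape it passes at once to colon ideals and to unions of chains.\<close>

definition graded_ideal :: "nat \<Rightarrow> 'k::field mpoly set \<Rightarrow> bool" where
  "graded_ideal n I \<longleftrightarrow> ideal I (mpoly_ring n) \<and> (\<forall>p\<in>I. \<forall>t. part t p \<in> I)"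

lemma ideal_mpolyD:
  fixes I :: "'k::field mpoly set"
  assumes "ideal I (mpoly_ring n)"
  shows "I \<subseteq> polys n" "0 \<in> I" "\<And>p q. p \<in> I \<Longrightarrow> q \<in> I \<Longrightarrow> p + q \<in> I"
    "\<And>r p. p \<in> I \<Longrightarrow> r \<in> polys n \<Longrightarrow> r * p \<in> I"
    "\<And>r p. p \<in> I \<Longrightarrow> r \<in> polys n \<Longrightarrow> p * r \<in> I"
    "\<And>c p. p \<in> I \<Longrightarrow> mpoly_scale c p \<in> I"
proof -
  show "I \<subseteq> polys n" "0 \<in> I" "\<And>p q. p \<in> I \<Longrightarrow> q \<in> I \<Longrightarrow> p + q \<in> I"
    and mult: "\<And>r p. p \<in> I \<Longrightarrow> r \<in> polys n \<Longrightarrow> r * p \<in> I"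
    using assms unfolding ideal_mpoly_iff by auto
  show "\<And>r p. p \<in> I \<Longrightarrow> r \<in> polys n \<Longrightarrow> p * r \<in> I"
    using mult by (subst mult.commute)
  show "\<And>c p. p \<in> I \<Longrightarrow> mpoly_scale c p \<in> I"
    unfolding mpoly_scale_def by (intro mult polys_single zero_expos)
qed

lemma ideal_mpoly_sum:
  assumes "ideal I (mpoly_ring n)" "\<And>i. i \<in> A \<Longrightarrow> f i \<in> I"
  shows "sum f A \<in> I"
  using assms(2) by (induction A rule: infinite_finite_induct) (auto simp: ideal_mpolyD[OF assms(1)])

lemma graded_idealD:
  assumes "graded_ideal n I"
  shows "ideal I (mpoly_ring n)" "p \<in> I \<Longrightarrow> part t p \<in> I"
  using assms by (auto simp: graded_ideal_def)

lemma ideal_mpoly_uminus: "ideal I (mpoly_ring n) \<Longrightarrow> p \<in> I \<Longrightarrow> - p \<in> I"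
  using ideal_mpolyD(6)[of I n p "-1"] by (simp add: mp.scale_minus_left)

lemma ideal_mpoly_diff: "ideal I (mpoly_ring n) \<Longrightarrow> p \<in> I \<Longrightarrow> q \<in> I \<Longrightarrow> p - q \<in> I"
  using ideal_mpolyD(3)[of I n p "- q"] ideal_mpoly_uminus by fastforce

lemma forms_subset_idealI:
  fixes I :: "'k::field mpoly set"
  assumes "ideal I (mpoly_ring n)" "\<And>a. a \<in> mons {..<n} t \<Longrightarrow> monomial a \<in> I"
  shows "forms n t \<subseteq> I"
proof
  fix p :: "'k mpoly" assume "p \<in> forms n t"
  then have "p = (\<Sum>a\<in>mons {..<n} t. mpoly_scale (Poly_Mapping.lookup p a) (monomial a))"
    by (rule forms_expand)
  also have "\<dots> \<in> I"
    using assms by (intro ideal_mpoly_sum ideal_mpolyD(6)) auto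
  finally show "p \<in> I" .
qed

lemma forms_subset_ideal_mono:
  fixes I :: "'k::field mpoly set"
  assumes I: "ideal I (mpoly_ring n)" and sub: "forms n t \<subseteq> I" and "t \<le> u"
  shows "forms n u \<subseteq> I"
  using \<open>t \<le> u\<close>
proof (induction u rule: dec_induct)
  case (step u)
  show ?case
  proof (rule forms_subset_idealI[OF I])
    fix a assume "a \<in> mons {..<n} (Suc u)"
    then obtain i b where b: "i \<in> {..<n}" "b \<in> mons {..<n} u" "a = Poly_Mapping.single i 1 + b"
      by (rule mons_SucE)
    then have "monomial b \<in> I"
      using step.IH forms_monomial by blast
    with b show "monomial a \<in> I"
      by (auto simp: monomial_add intro!: ideal_mpolyD(4)[OF I] polys_monomial mons_expos mons_single)
  qed
qed (fact sub)

text \<open>Multiplication by an arbitrary polynomial respects homogeneous parts as soon as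
  multiplication by the terms of that polynomial does.\<close>

lemma part_mult_closed:
  fixes I :: "'k::field mpoly set"
  assumes I: "ideal I (mpoly_ring n)" and p: "p \<in> polys n" "\<And>t. part t p \<in> I"
    and r: "r \<in> polys n"
  shows "part t (r * p) \<in> I"
proof -
  have mon: "part t (monomial a * p) \<in> I" if "a \<in> expos n" for a
  proof (cases "t < expo_deg a")
    case True
    then show ?thesis
      using part_mult_form(2)[OF forms_monomial[OF expos_mons[OF that]] p(1)] ideal_mpolyD(2)[OF I]
      by simp
  next
    case False
    then have "part t (monomial a * p) = monomial a * part (t - expo_deg a) p"
      using part_mult_form(1)[OF forms_monomial[OF expos_mons[OF that]] p(1), of "t - expo_deg a"]
      by simp
    then show ?thesis
      using ideal_mpolyD(4)[OF I p(2) polys_monomial[OF that]] by simp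
  qed
  have scale: "part t (mpoly_scale c q) = mpoly_scale c (part t q)" for c and q :: "'k mpoly"
    by (auto intro!: poly_mapping_eqI simp: lookup_part)
  have "r * p = (\<Sum>a\<in>Poly_Mapping.keys r. mpoly_scale (Poly_Mapping.lookup r a) (monomial a)) * p"
    using mpoly_expand[of "Poly_Mapping.keys r" r] by simp
  then have "part t (r * p)
      = (\<Sum>a\<in>Poly_Mapping.keys r. mpoly_scale (Poly_Mapping.lookup r a) (part t (monomial a * p)))"
    by (simp add: sum_distrib_right scale_mult_left part_sum scale)
  also have "\<dots> \<in> I"
    using r mon by (intro ideal_mpoly_sum[OF I] ideal_mpolyD(6)[OF I]) (auto simp: polys_iff)
  finally show ?thesis .
qed

lemma homogeneous_imp_graded:
  fixes I :: "'k::field mpoly set"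
  assumes "homogeneous_ideal n I"
  shows "graded_ideal n I"
proof -
  interpret R: cring "mpoly_ring n :: 'k mpoly ring" by (rule cring_mpoly_ring)
  obtain S :: "'k mpoly set" where S: "S \<subseteq> (\<Union>t. forms n t)" "I = genideal (mpoly_ring n) S"
    using assms by (auto simp: homogeneous_ideal_def)
  have Sp: "S \<subseteq> polys n"
    using S(1) forms_polys by blast
  have I: "ideal I (mpoly_ring n)"
    unfolding S(2) using Sp by (rule R.genideal_ideal)
  let ?I = "{p \<in> I. \<forall>t. part t p \<in> I}"
  have "ideal ?I (mpoly_ring n)"
    unfolding ideal_mpoly_iff using ideal_mpolyD[OF I] part_mult_closed[OF I]
    by (auto simp: part_add subset_iff)
  moreover have "S \<subseteq> ?I"
  proof
    fix p assume "p \<in> S"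
    then obtain t where "p \<in> forms n t" "p \<in> I"
      using S(1) R.genideal_self[OF Sp] S(2) by auto
    then show "p \<in> ?I"
      using ideal_mpolyD(2)[OF I] by (simp add: part_forms)
  qed
  ultimately have "I \<subseteq> ?I"
    unfolding S(2) by (rule R.genideal_minimal)
  with I show ?thesis
    by (auto simp: graded_ideal_def)
qed

section \<open>Adjoining linear forms to an ideal\<close>

(* Degree 1 is written as the numeral throughout, so it must not be rewritten to Suc 0. *)
declare One_nat_def [simp del]

lemma sum_lessThan_one [simp]: "(\<Sum>i<1::nat. f i) = f 0"
  by (simp add: One_nat_def)

definition adjoin :: "nat \<Rightarrow> 'k::field mpoly set \<Rightarrow> nat \<Rightarrow> (nat \<Rightarrow> 'k mpoly) \<Rightarrow> 'k mpoly set" where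
  "adjoin n I s z = {q + (\<Sum>i<s. z i * g i) | q g. q \<in> I \<and> (\<forall>i<s. g i \<in> polys n)}"

lemma adjoinI:
  "q \<in> I \<Longrightarrow> (\<And>i. i < s \<Longrightarrow> g i \<in> polys n) \<Longrightarrow> q + (\<Sum>i<s. z i * g i) \<in> adjoin n I s z"
  by (auto simp: adjoin_def)

lemma adjoinE:
  assumes "p \<in> adjoin n I s z"
  obtains q g where "q \<in> I" "\<And>i. i < s \<Longrightarrow> g i \<in> polys n" "p = q + (\<Sum>i<s. z i * g i)"
  using assms by (auto simp: adjoin_def)

lemma adjoin_singleE:
  assumes "p \<in> adjoin n I 1 (\<lambda>_. h)"
  shows "\<exists>q\<in>I. \<exists>r\<in>polys n. p = q + h * r"
proof -
  from assms obtain q g where q: "p = q + (\<Sum>i<1::nat. h * g i)" "q \<in> I" "\<forall>i<1::nat. g i \<in> polys n"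
    unfolding adjoin_def mem_Collect_eq by (elim exE conjE)
  then show ?thesis
    by (intro bexI[OF _ q(2)] bexI[of _ "g 0"]) simp_all
qed

lemma subset_adjoin: "I \<subseteq> adjoin n I s z"
  using adjoinI[of _ I s "\<lambda>_. 0" n z] by auto

lemma generator_in_adjoin:
  assumes "0 \<in> I" "i < s"
  shows "z i \<in> adjoin n I s z"
proof -
  have "(\<Sum>j<s. z j * (if j = i then 1 else 0)) = z i"
    using assms(2) by (simp add: if_distrib cong: if_cong)
  then show ?thesis
    using adjoinI[OF assms(1), of s "\<lambda>j. if j = i then 1 else 0" n z] by simp
qed

lemma adjoin_mono: "I \<subseteq> J \<Longrightarrow> adjoin n I s z \<subseteq> adjoin n J s z"
  by (auto simp: adjoin_def)

lemma adjoin_minimal: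
  assumes "ideal J (mpoly_ring n)" "I \<subseteq> J" "\<And>i. i < s \<Longrightarrow> z i \<in> J"
  shows "adjoin n I s z \<subseteq> J"
  using assms(2,3)
  by (auto elim!: adjoinE intro!: ideal_mpolyD(3)[OF assms(1)] ideal_mpoly_sum[OF assms(1)]
      ideal_mpolyD(5)[OF assms(1)])

lemma ideal_adjoin:
  assumes I: "ideal I (mpoly_ring n)" and z: "\<And>i. i < s \<Longrightarrow> z i \<in> polys n"
  shows "ideal (adjoin n I s z) (mpoly_ring n)"
  unfolding ideal_mpoly_iff
proof (intro conjI ballI subsetI)
  fix p assume "p \<in> adjoin n I s z"
  then obtain q g where q: "q \<in> I" "\<And>i. i < s \<Longrightarrow> g i \<in> polys n" "p = q + (\<Sum>i<s. z i * g i)"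
    by (rule adjoinE) (rule that, assumption+)
  show "p \<in> polys n"
    unfolding q(3) using q(1,2) z ideal_mpolyD(1)[OF I] by (intro polys_add polys_sum polys_mult) auto
next
  show "0 \<in> adjoin n I s z"
    using subset_adjoin ideal_mpolyD(2)[OF I] by blast
next
  fix p p' assume "p \<in> adjoin n I s z" "p' \<in> adjoin n I s z"
  from this(1) obtain q g where q: "q \<in> I" "\<And>i. i < s \<Longrightarrow> g i \<in> polys n"
    "p = q + (\<Sum>i<s. z i * g i)"
    by (rule adjoinE) (rule that, assumption+)
  from \<open>p' \<in> adjoin n I s z\<close> obtain q' g' where q': "q' \<in> I" "\<And>i. i < s \<Longrightarrow> g' i \<in> polys n"
    "p' = q' + (\<Sum>i<s. z i * g' i)"
    by (rule adjoinE) (rule that, assumption+)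
  from q q' have "p + p' = (q + q') + (\<Sum>i<s. z i * (g i + g' i))"
    by (simp add: distrib_left sum.distrib)
  also have "\<dots> \<in> adjoin n I s z"
    using q q' ideal_mpolyD(3)[OF I] by (intro adjoinI) (auto simp: polys_add)
  finally show "p + p' \<in> adjoin n I s z" .
next
  fix p r :: "'a mpoly" assume r: "r \<in> polys n" and "p \<in> adjoin n I s z"
  from this(2) obtain q g where q: "q \<in> I" "\<And>i. i < s \<Longrightarrow> g i \<in> polys n" "p = q + (\<Sum>i<s. z i * g i)"
    by (rule adjoinE) (rule that, assumption+)
  then have "r * p = r * q + (\<Sum>i<s. z i * (r * g i))"
    by (simp add: distrib_left sum_distrib_left mult_ac)
  also have "\<dots> \<in> adjoin n I s z"
    using q r ideal_mpolyD(4)[OF I] by (intro adjoinI) (auto simp: polys_mult)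
  finally show "r * p \<in> adjoin n I s z" .
qed

lemma graded_adjoin_forms:
  assumes I: "graded_ideal n I" and z: "\<And>i. i < s \<Longrightarrow> z i \<in> forms n d"
  shows "graded_ideal n (adjoin n I s z)"
  unfolding graded_ideal_def
proof (intro conjI ballI allI)
  show A: "ideal (adjoin n I s z) (mpoly_ring n)"
    using forms_polys[OF z] by (intro ideal_adjoin graded_idealD(1)[OF I])
  have zA: "z i \<in> adjoin n I s z" if "i < s" for i
    using ideal_mpolyD(2)[OF graded_idealD(1)[OF I]] that by (rule generator_in_adjoin)
  fix p t assume "p \<in> adjoin n I s z"
  then obtain q g where q: "q \<in> I" "\<And>i. i < s \<Longrightarrow> g i \<in> polys n" "p = q + (\<Sum>i<s. z i * g i)"
    by (rule adjoinE) (rule that, assumption+)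
  have "part t q \<in> adjoin n I s z"
    using graded_idealD(2)[OF I q(1)] subset_adjoin by blast
  moreover have "part t (z i * g i) \<in> adjoin n I s z" if "i < s" for i
  proof (cases "t < d")
    case True
    then show ?thesis
      using part_mult_form(2)[OF z[OF that] q(2)[OF that]] ideal_mpolyD(2)[OF A] by simp
  next
    case False
    then show ?thesis
      using part_mult_form(1)[OF z[OF that] q(2)[OF that], of "t - d"] zA[OF that]
        ideal_mpolyD(5)[OF A _ part_polys[OF q(2)[OF that]]] by simp
  qed
  ultimately show "part t p \<in> adjoin n I s z"
    unfolding q(3) part_add part_sum by (intro ideal_mpolyD(3)[OF A] ideal_mpoly_sum[OF A]) auto
qed

text \<open>The cofactors of a form of degree \<open>t\<close> can be taken homogeneous of degree \<open>t - 1\<close>.  The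
  products with linear forms are mentioned for the sake of the degenerate case \<open>t = 0\<close>, in which the
  cofactors vanish.\<close>

lemma adjoin_homogeneous_cofactors:
  assumes I: "graded_ideal n I" and z: "\<And>i. i < s \<Longrightarrow> z i \<in> forms n 1"
    and p: "p \<in> adjoin n I s z" "p \<in> forms n t"
  obtains q g where "q \<in> I" "q \<in> forms n t" "\<And>i. g i \<in> forms n (t - 1)"
    "\<And>i y. y \<in> forms n 1 \<Longrightarrow> y * g i \<in> forms n t" "p = q + (\<Sum>i<s. z i * g i)"
proof -
  obtain q g where q: "q \<in> I" "\<And>i. i < s \<Longrightarrow> g i \<in> polys n" "p = q + (\<Sum>i<s. z i * g i)"
    using p(1) by (rule adjoinE) (rule that, assumption+)
  define h where "h i = (if t = 0 \<or> i \<ge> s then 0 else part (t - 1) (g i))" for i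
  have "part t (z i * g i) = z i * h i" if "i < s" for i
  proof (cases t)
    case 0
    then show ?thesis
      using part_mult_form(2)[OF z[OF that] q(2)[OF that], of t] by (simp add: h_def)
  next
    case (Suc u)
    then show ?thesis
      using part_mult_form(1)[OF z[OF that] q(2)[OF that], of u] that by (simp add: h_def flip: Suc_eq_plus1_left)
  qed
  then have "(\<Sum>i<s. part t (z i * g i)) = (\<Sum>i<s. z i * h i)"
    by (intro sum.cong) auto
  then have "p = part t q + (\<Sum>i<s. z i * h i)"
    using part_forms[OF p(2), of t] by (simp add: q(3) part_add part_sum)
  moreover have "part t q \<in> I" "part t q \<in> forms n t"
    using graded_idealD[OF I] q(1) ideal_mpolyD(1) part_in_forms by blast+
  moreover have "h i \<in> forms n (t - 1)" for i
    using q(2) by (simp add: h_def part_in_forms)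
  moreover have "y * h i \<in> forms n t" if "y \<in> forms n 1" for i y
    using forms_mult[OF that part_in_forms[OF q(2)], of i "t - 1"] by (auto simp: h_def)
  ultimately show thesis by (rule that[rotated 4])
qed

text \<open>The linear forms generate an ideal of \<open>R/I\<close> which contains everything of degree \<open>t\<close>, hence of
  every higher degree.  Thus \<open>r\<^sub>s(R/I)\<close> is the least \<open>r\<close> such that \<open>reducible n I s (r + 1)\<close>, provided that
  there is such an \<open>r\<close>.\<close>

definition reducible :: "nat \<Rightarrow> 'k::field mpoly set \<Rightarrow> nat \<Rightarrow> nat \<Rightarrow> bool" where
  "reducible n I s t \<longleftrightarrow>
    (\<exists>z. (\<forall>i<s. z i \<in> forms n 1) \<and> forms n t \<subseteq> adjoin n I s z)"

lemma reducibleI: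
  "(\<And>i. i < s \<Longrightarrow> z i \<in> forms n 1) \<Longrightarrow> forms n t \<subseteq> adjoin n I s z \<Longrightarrow> reducible n I s t"
  by (auto simp: reducible_def)

section \<open>Generic linear forms\<close>

text \<open>Being a reduction is an open condition along a line of tuples of linear forms.  If the
  monomials \<open>X k\<close> of degree \<open>t\<close> are written in terms of \<open>I\<close> and \<open>z\<close>, then replacing \<open>z\<close> by
  \<open>\<mu> z + w\<close> and the elements of \<open>I\<close> by their \<open>\<mu>\<close>-fold in these expressions multiplies the vector of the
  \<open>X k\<close> by a matrix \<open>\<mu> 1 - E\<close>, which is invertible unless \<open>\<mu>\<close> is an eigenvalue of \<open>E\<close>.\<close>

lemma finite_non_reductions_on_line:
  fixes I :: "'k::field mpoly set"
  assumes I: "graded_ideal n I"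
    and z: "\<And>i. i < s \<Longrightarrow> z i \<in> forms n 1" and w: "\<And>i. i < s \<Longrightarrow> w i \<in> forms n 1"
    and red: "forms n t \<subseteq> adjoin n I s z"
  shows "finite {\<mu>. \<not> forms n t \<subseteq> adjoin n I s (\<lambda>i. mpoly_scale \<mu> (z i) + w i)}"
proof -
  define N where "N = card (mons {..<n} t)"
  obtain a where a: "bij_betw a {0..<N} (mons {..<n} t)"
    unfolding N_def using ex_bij_betw_nat_finite[OF finite_mons[of "{..<n}" t]] by auto
  have a_mem: "a k \<in> mons {..<n} t" if "k < N" for k
    using a that by (auto simp: bij_betw_def)
  have a_ex: "\<exists>k<N. b = a k" if "b \<in> mons {..<n} t" for b
    using a that by (auto simp: bij_betw_def) (metis atLeastLessThan_iff imageE)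
  have a_inj: "a k = a l \<longleftrightarrow> k = l" if "k < N" "l < N" for k l
    using a that by (auto simp: bij_betw_def inj_on_def)
  have "\<exists>x. fst x \<in> I \<and> (\<forall>i. snd x i \<in> forms n (t - 1)) \<and>
      (\<forall>i. \<forall>y\<in>forms n 1. y * snd x i \<in> forms n t) \<and>
      monomial (a k) = fst x + (\<Sum>i<s. z i * snd x i)" (is "\<exists>x. ?P k x") if "k < N" for k
  proof -
    have "(monomial (a k) :: 'k mpoly) \<in> forms n t"
      using a_mem[OF that] by (rule forms_monomial)
    with red have h: "monomial (a k) \<in> adjoin n I s z" "(monomial (a k) :: 'k mpoly) \<in> forms n t" by auto
    obtain q g where "q \<in> I" "q \<in> forms n t" "\<And>i. g i \<in> forms n (t - 1)"
      "\<And>i y. y \<in> forms n 1 \<Longrightarrow> y * g i \<in> forms n t" "monomial (a k) = q + (\<Sum>i<s. z i * g i)"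
      by (rule adjoin_homogeneous_cofactors[OF I _ h]) (rule z, assumption, rule that, assumption+)
    then show ?thesis by (intro exI[of _ "(q, g)"]) simp
  qed
  then have "\<forall>k\<in>{..<N}. \<exists>x. ?P k x" by blast
  from bchoice[OF this] obtain x where x: "\<And>k. k < N \<Longrightarrow> ?P k (x k)" by blast
  define q where "q k = fst (x k)" for k
  define g where "g k = snd (x k)" for k
  have q: "q k \<in> I" and g: "g k i \<in> polys n" and X: "monomial (a k) = q k + (\<Sum>i<s. z i * g k i)"
    and gf: "y \<in> forms n 1 \<Longrightarrow> y * g k i \<in> forms n t"
    if "k < N" for k i y
    using x[OF that] by (auto simp: q_def g_def intro: forms_polys)
  define e where "e k = (\<Sum>i<s. w i * g k i)" for k
  have e: "e k \<in> forms n t" if "k < N" for k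
    unfolding e_def using gf[OF that w] by (intro forms_sum) auto
  define E where "E = mat N N (\<lambda>(k, l). - Poly_Mapping.lookup (e k) (a l))"
  have E: "E \<in> carrier_mat N N" by (simp add: E_def)
  have "forms n t \<subseteq> adjoin n I s (\<lambda>i. mpoly_scale \<mu> (z i) + w i)"
    if \<mu>: "poly (char_poly E) \<mu> \<noteq> 0" for \<mu>
  proof -
    let ?y = "\<lambda>i. mpoly_scale \<mu> (z i) + w i"
    have y: "?y i \<in> forms n 1" if "i < s" for i
      using z w that by (intro forms_add forms_scale)
    have A: "ideal (adjoin n I s ?y) (mpoly_ring n)"
      using forms_polys[OF y] by (intro ideal_adjoin graded_idealD(1)[OF I])
    define u where "u k = mpoly_scale \<mu> (monomial (a k)) + e k" for k
    have u: "u k \<in> adjoin n I s ?y" if "k < N" for k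
    proof -
      have "u k = mpoly_scale \<mu> (q k) + (\<Sum>i<s. ?y i * g k i)"
        unfolding u_def e_def X[OF that]
        by (simp add: mp.scale_right_distrib mp.scale_sum_right distrib_right sum.distrib
            scale_mult_left add.assoc)
      also have "\<dots> \<in> adjoin n I s ?y"
        using g[OF that] ideal_mpolyD(6)[OF graded_idealD(1)[OF I] q[OF that]] by (intro adjoinI)
      finally show ?thesis .
    qed
    define M where "M = - char_matrix E \<mu>"
    have M: "M \<in> carrier_mat N N"
      using E by (simp add: M_def)
    have M_entry: "M $$ (k, l) = (if k = l then \<mu> else 0) + Poly_Mapping.lookup (e k) (a l)"
      if "k < N" "l < N" for k l
      using that by (simp add: M_def char_matrix_def E_def)
    have "det M \<noteq> 0"
      using \<mu> by (simp add: M_def char_poly_matrix[OF E])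
    then obtain C where C: "C \<in> carrier_mat N N" "C * M = 1\<^sub>m N"
      using det_non_zero_imp_unit[OF M, of "()"] by (auto simp: Units_def ring_mat_def)
    show ?thesis
    proof (rule forms_subset_idealI[OF A])
      fix b assume "b \<in> mons {..<n} t"
      then obtain l where l: "l < N" "b = a l"
        using a_ex by blast
      have "monomial b = (\<Sum>k<N. mpoly_scale (C $$ (l, k)) (u k))"
      proof (rule poly_mapping_eqI)
        fix c
        show "Poly_Mapping.lookup (monomial b) c
          = Poly_Mapping.lookup (\<Sum>k<N. mpoly_scale (C $$ (l, k)) (u k)) c"
        proof (cases "c \<in> mons {..<n} t")
          case True
          then obtain m where m: "m < N" "c = a m"
            using a_ex by blast
          have "Poly_Mapping.lookup (\<Sum>k<N. mpoly_scale (C $$ (l, k)) (u k)) c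
              = (\<Sum>k<N. C $$ (l, k) * M $$ (k, m))"
            unfolding lookup_sum using m
            by (intro sum.cong) (auto simp: u_def lookup_add lookup_monomial M_entry a_inj)
          also have "\<dots> = (C * M) $$ (l, m)"
            using C(1) M l(1) m(1) by (simp add: scalar_prod_def lessThan_atLeast0)
          also have "\<dots> = Poly_Mapping.lookup (monomial b) c"
            using l m by (simp add: C(2) lookup_monomial a_inj)
          finally show ?thesis by simp
        next
          case False
          then have zero: "Poly_Mapping.lookup p c = 0" if "p \<in> forms n t" for p :: "'k mpoly"
            using that by (auto simp: forms_iff subset_iff in_keys_iff)
          have uf: "u k \<in> forms n t" if "k < N" for k
            unfolding u_def using e a_mem that by (intro forms_add forms_scale forms_monomial) auto
          have "(\<Sum>k<N. mpoly_scale (C $$ (l, k)) (u k)) \<in> forms n t"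
            using uf by (intro forms_sum forms_scale) auto
          moreover have "(monomial b :: 'k mpoly) \<in> forms n t"
            using a_mem l by (intro forms_monomial) auto
          ultimately show ?thesis
            by (simp only: zero)
        qed
      qed
      also have "\<dots> \<in> adjoin n I s ?y"
        using u by (intro ideal_mpoly_sum[OF A] ideal_mpolyD(6)[OF A]) auto
      finally show "monomial b \<in> adjoin n I s ?y" .
    qed
  qed
  then have "{\<mu>. \<not> forms n t \<subseteq> adjoin n I s (\<lambda>i. mpoly_scale \<mu> (z i) + w i)}
      \<subseteq> {\<mu>. poly (char_poly E) \<mu> = 0}"
    by blast
  moreover have "char_poly E \<noteq> 0"
    using degree_monic_char_poly[OF E] by auto
  ultimately show ?thesis
    using finite_subset poly_roots_finite by blast
qed

text \<open>Over an infinite field finitely many nonempty open conditions hold simultaneously.  A tuple \<open>z\<close>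
  which is good for the ideals treated so far and a tuple \<open>w\<close> which is good for one more ideal are
  joined by a line.\<close>

lemma common_reduction:
  fixes I :: "'b \<Rightarrow> 'k::field mpoly set"
  assumes k: "infinite (UNIV :: 'k set)" and "finite A"
    and "\<And>j. j \<in> A \<Longrightarrow> graded_ideal n (I j)" "\<And>j. j \<in> A \<Longrightarrow> reducible n (I j) s (t j)"
  obtains z where "\<And>i. i < s \<Longrightarrow> z i \<in> forms n 1"
    "\<And>j. j \<in> A \<Longrightarrow> forms n (t j) \<subseteq> adjoin n (I j) s z"
proof -
  have "\<exists>z. (\<forall>i<s. z i \<in> forms n 1) \<and> (\<forall>j\<in>A. forms n (t j) \<subseteq> adjoin n (I j) s z)"
    using assms(2-4)
  proof (induction A rule: finite_induct)
    case empty
    then show ?case by (intro exI[of _ "\<lambda>_. 0"]) simp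
  next
    case (insert j A)
    have "\<exists>z. (\<forall>i<s. z i \<in> forms n 1) \<and> (\<forall>j\<in>A. forms n (t j) \<subseteq> adjoin n (I j) s z)"
      by (rule insert.IH) (use insert.prems in auto)
    then obtain z where "\<forall>i<s. z i \<in> forms n 1"
      "\<forall>j\<in>A. forms n (t j) \<subseteq> adjoin n (I j) s z"
      by blast
    then have z: "\<And>i. i < s \<Longrightarrow> z i \<in> forms n 1"
      "\<And>j. j \<in> A \<Longrightarrow> forms n (t j) \<subseteq> adjoin n (I j) s z"
      by auto
    obtain w where w: "\<And>i. i < s \<Longrightarrow> w i \<in> forms n 1"
      "forms n (t j) \<subseteq> adjoin n (I j) s w"
      using insert.prems(2)[of j] by (auto simp: reducible_def)
    define B where "B = {\<mu>. \<not> forms n (t j) \<subseteq> adjoin n (I j) s (\<lambda>i. mpoly_scale \<mu> (w i) + z i)}"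
    define D where "D = (\<Union>l\<in>A. {\<mu>. \<not> forms n (t l) \<subseteq> adjoin n (I l) s (\<lambda>i. mpoly_scale \<mu> (z i) + w i)})"
    have "finite B"
      unfolding B_def using insert.prems(1) z(1) w
      by (intro finite_non_reductions_on_line) auto
    moreover have "finite D"
      unfolding D_def using insert.prems(1) insert.hyps(1) z w(1)
      by (intro finite_UN_I finite_non_reductions_on_line) auto
    ultimately have "finite (insert 0 (inverse ` B) \<union> D)"
      by simp
    then obtain \<mu> where \<mu>: "\<mu> \<notin> insert 0 (inverse ` B) \<union> D"
      using k by (metis ex_new_if_finite)
    let ?y = "\<lambda>i. mpoly_scale \<mu> (z i) + w i"
    have y: "?y i \<in> forms n 1" if "i < s" for i
      using z(1) w(1) that by (intro forms_add forms_scale)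
    have Aj: "ideal (adjoin n (I j) s ?y) (mpoly_ring n)"
      using forms_polys[OF y] insert.prems(1)[of j]
      by (intro ideal_adjoin graded_idealD(1)[of n "I j"]) auto
    \<comment> \<open>Up to the factor \<open>\<mu>\<close>, the tuple \<open>\<mu> z + w\<close> is also the point with parameter \<open>1/\<mu>\<close> on the line
      from \<open>w\<close> in direction \<open>z\<close>, which is the line controlled by \<open>B\<close>.\<close>
    have "inverse \<mu> \<notin> B"
      using \<mu> by (metis UnI1 image_eqI insertI2 inverse_inverse_eq)
    then have "forms n (t j) \<subseteq> adjoin n (I j) s (\<lambda>i. mpoly_scale (inverse \<mu>) (w i) + z i)"
      by (simp add: B_def)
    also have "\<dots> \<subseteq> adjoin n (I j) s ?y"
    proof (rule adjoin_minimal[OF Aj subset_adjoin])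
      fix i assume "i < s"
      have "mpoly_scale (inverse \<mu>) (?y i) \<in> adjoin n (I j) s ?y"
        using \<open>i < s\<close> ideal_mpolyD(2)[OF graded_idealD(1)[OF insert.prems(1)[of j]]]
        by (intro ideal_mpolyD(6)[OF Aj] generator_in_adjoin[where z = ?y]) auto
      moreover have "mpoly_scale (inverse \<mu>) (?y i) = mpoly_scale (inverse \<mu>) (w i) + z i"
        using \<mu> by (simp add: mp.scale_right_distrib add.commute)
      ultimately show "mpoly_scale (inverse \<mu>) (w i) + z i \<in> adjoin n (I j) s ?y" by simp
    qed
    finally have "forms n (t j) \<subseteq> adjoin n (I j) s ?y" .
    moreover have "forms n (t l) \<subseteq> adjoin n (I l) s ?y" if "l \<in> A" for l
      using \<mu> that by (auto simp: D_def)
    ultimately show ?case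
      using y by (intro exI[of _ ?y]) auto
  qed
  then show thesis using that by blast
qed

section \<open>Codimension and the Eakin-Sathaye theorem\<close>

definition indep_mod :: "'k::field mpoly set \<Rightarrow> (nat \<Rightarrow> 'k mpoly) \<Rightarrow> nat \<Rightarrow> bool" where
  "indep_mod V f m \<longleftrightarrow> (\<forall>u. (\<Sum>i<m. mpoly_scale (u i) (f i)) \<in> V \<longrightarrow> (\<forall>i<m. u i = 0))"

text \<open>The Hilbert function of \<open>R/V\<close> at \<open>t\<close> is less than \<open>m\<close>.  The phrasing by independent families makes
  its behaviour along exact sequences a matter of concatenating families.\<close>

definition codim_less :: "nat \<Rightarrow> 'k::field mpoly set \<Rightarrow> nat \<Rightarrow> nat \<Rightarrow> bool" where
  "codim_less n V t m \<longleftrightarrow> \<not> (\<exists>f. (\<forall>i<m. f i \<in> forms n t) \<and> indep_mod V f m)"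

lemma codim_less_1D:
  fixes V :: "'k::field mpoly set"
  assumes V: "ideal V (mpoly_ring n)" and c: "codim_less n V t 1"
  shows "forms n t \<subseteq> V"
proof
  fix p :: "'k mpoly" assume p: "p \<in> forms n t"
  show "p \<in> V"
  proof (rule ccontr)
    assume "p \<notin> V"
    have "c = 0" if "mpoly_scale c p \<in> V" for c
      using ideal_mpolyD(6)[OF V that, of "inverse c"] \<open>p \<notin> V\<close> by (cases "c = 0") auto
    then have "indep_mod V (\<lambda>_. p) 1"
      by (simp add: indep_mod_def)
    with c p show False
      by (auto simp: codim_less_def)
  qed
qed

definition colon :: "nat \<Rightarrow> 'k::field mpoly set \<Rightarrow> 'k mpoly \<Rightarrow> 'k mpoly set" where
  "colon n I l = {p \<in> polys n. l * p \<in> I}"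

lemma graded_colon:
  assumes I: "graded_ideal n I" and l: "l \<in> forms n d"
  shows "graded_ideal n (colon n I l)"
  unfolding graded_ideal_def ideal_mpoly_iff
proof (intro conjI ballI allI)
  note D = ideal_mpolyD[OF graded_idealD(1)[OF I]]
  show "colon n I l \<subseteq> polys n" "0 \<in> colon n I l"
    using D(2) by (auto simp: colon_def)
  show "p + q \<in> colon n I l" if "p \<in> colon n I l" "q \<in> colon n I l" for p q
    using that D(3) by (auto simp: colon_def polys_add distrib_left)
  show "r * p \<in> colon n I l" if "p \<in> colon n I l" "r \<in> polys n" for p r
    using that D(4)[of "l * p" r] by (auto simp: colon_def polys_mult mult_ac)
  fix p t assume p: "p \<in> colon n I l"
  then have "part (d + t) (l * p) \<in> I"
    using graded_idealD(2)[OF I] by (auto simp: colon_def)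
  then show "part t p \<in> colon n I l"
    using p part_mult_form(1)[OF l, of p t] by (auto simp: colon_def part_polys)
qed

text \<open>Multiplication by \<open>l\<close> gives an exact sequence
  \<open>0 \<rightarrow> R/(I : l) \<rightarrow> R/I \<rightarrow> R/(I + l) \<rightarrow> 0\<close>, which raises degrees by one at its first
  map.  Independent families at both ends combine to one in the middle.\<close>

lemma codim_less_adjoin_or_colon:
  fixes I :: "'k::field mpoly set"
  assumes I: "ideal I (mpoly_ring n)" and l: "l \<in> forms n 1"
    and c: "codim_less n I (Suc t) (m1 + m2)"
  shows "codim_less n (adjoin n I 1 (\<lambda>_. l)) (Suc t) m1 \<or> codim_less n (colon n I l) t m2"
proof (rule ccontr)
  assume "\<not> ?thesis"
  then obtain f g :: "nat \<Rightarrow> 'k mpoly"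
    where f: "\<And>i. i < m1 \<Longrightarrow> f i \<in> forms n (Suc t)" "indep_mod (adjoin n I 1 (\<lambda>_. l)) f m1"
      and g: "\<And>i. i < m2 \<Longrightarrow> g i \<in> forms n t" "indep_mod (colon n I l) g m2"
    by (auto simp: codim_less_def)
  define h where "h i = (if i < m1 then f i else l * g (i - m1))" for i
  have "h i \<in> forms n (Suc t)" if "i < m1 + m2" for i
    using f(1) g(1)[of "i - m1"] forms_mult[OF l, of "g (i - m1)" t] that
    by (auto simp: h_def simp flip: Suc_eq_plus1_left)
  moreover have "indep_mod I h (m1 + m2)"
    unfolding indep_mod_def
  proof (rule allI, rule impI)
    fix u :: "nat \<Rightarrow> 'k"
    let ?F = "\<lambda>i. mpoly_scale (u i) (h i)"
    assume sum: "(\<Sum>i<m1 + m2. ?F i) \<in> I"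
    let ?a = "\<Sum>i<m1. mpoly_scale (u i) (f i)"
    let ?b = "\<Sum>j<m2. mpoly_scale (u (m1 + j)) (g j)"
    have "(\<Sum>i<m1 + m2. ?F i) = (\<Sum>i<m1. ?F i) + (\<Sum>j<m2. ?F (m1 + j))"
      by (induction m2) (simp_all add: add.assoc)
    also have "\<dots> = ?a + l * ?b"
      by (simp add: h_def sum_distrib_left scale_mult_right)
    finally have ab: "?a + l * ?b \<in> I"
      using sum by simp
    have b: "?b \<in> polys n"
      using g(1) by (intro polys_sum polys_scale forms_polys) auto
    have "(?a + l * ?b) + (\<Sum>i<1::nat. l * - ?b) \<in> adjoin n I 1 (\<lambda>_. l)"
      using ab polys_scale[OF b, of "- 1"]
      by (intro adjoinI[of "?a + l * ?b" I 1 "\<lambda>_. - ?b" n "\<lambda>_. l"]) (simp_all add: mp.scale_minus_left)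
    then have "?a \<in> adjoin n I 1 (\<lambda>_. l)"
      by simp
    then have u1: "u i = 0" if "i < m1" for i
      using f(2) that by (auto simp: indep_mod_def)
    then have "?a = 0"
      by simp
    with ab b have "?b \<in> colon n I l"
      by (simp add: colon_def)
    then have u2: "u (m1 + j) = 0" if "j < m2" for j
      using g(2) that unfolding indep_mod_def by (auto dest: spec[of _ "\<lambda>j. u (m1 + j)"])
    show "\<forall>i<m1 + m2. u i = 0"
    proof (intro allI impI)
      fix i assume "i < m1 + m2"
      then show "u i = 0"
        using u1[of i] u2[of "i - m1"] by (cases "i < m1") auto
    qed
  qed
  ultimately show False
    using c by (auto simp: codim_less_def)
qed

lemma reducible_adjoin:
  assumes I: "ideal I (mpoly_ring n)" and l: "l \<in> forms n 1"
    and red: "reducible n (adjoin n I 1 (\<lambda>_. l)) s t"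
  shows "reducible n I (Suc s) t"
proof -
  obtain z where z: "\<And>i. i < s \<Longrightarrow> z i \<in> forms n 1"
    "forms n t \<subseteq> adjoin n (adjoin n I 1 (\<lambda>_. l)) s z"
    using red by (auto simp: reducible_def)
  let ?y = "z(s := l)"
  have y: "?y i \<in> forms n 1" if "i < Suc s" for i
    using z(1)[of i] l that by (auto simp: less_Suc_eq)
  have A: "ideal (adjoin n I (Suc s) ?y) (mpoly_ring n)"
    using I forms_polys[OF y] by (intro ideal_adjoin)
  have mem: "?y i \<in> adjoin n I (Suc s) ?y" if "i < Suc s" for i
    using ideal_mpolyD(2)[OF I] that by (rule generator_in_adjoin)
  have "adjoin n (adjoin n I 1 (\<lambda>_. l)) s z \<subseteq> adjoin n I (Suc s) ?y"
  proof (intro adjoin_minimal[OF A] subset_adjoin)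
    show "l \<in> adjoin n I (Suc s) ?y" using mem[of s] by simp
    show "z i \<in> adjoin n I (Suc s) ?y" if "i < s" for i using mem[of i] that by simp
  qed
  with z(2) y show ?thesis
    by (auto simp: reducible_def intro!: exI[of _ ?y])
qed

text \<open>The theorem of Eakin and Sathaye: a value of the Hilbert function of \<open>R/I\<close> below that of a
  polynomial ring in \<open>s + 1\<close> variables forces \<open>s\<close> linear forms to generate \<open>R/I\<close> in that degree \<open>t\<close>.
  By the Pascal recursion for the Hilbert functions of polynomial rings, each variable \<open>x\<close> falls under one of two
  cases.  Either the Hilbert function of \<open>R/(I + x)\<close> at \<open>t\<close> is below that of a polynomial ring in \<open>s\<close>
  variables.  If this happens for some \<open>x\<close>, then \<open>x\<close> is taken as one of the linear forms, and
  \<open>s - 1\<close> linear forms suffice for \<open>R/(I + x)\<close>.  Or the Hilbert function of \<open>R/(I : x)\<close> at \<open>t - 1\<close> is below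
  that of a polynomial ring in \<open>s + 1\<close> variables.  If this happens for all \<open>x\<close>, then the same \<open>s\<close> generic
  linear forms \<open>z\<close> generate all the \<open>R/(I : x)\<close> in degree \<open>t - 1\<close>, so that \<open>x R\<^sub>t\<^sub>-\<^sub>1 \<subseteq> I + (z)\<close> for all \<open>x\<close>,
  that is, \<open>R\<^sub>t \<subseteq> I + (z)\<close>.\<close>

theorem eakin_sathaye:
  fixes I :: "'k::field mpoly set"
  assumes k: "infinite (UNIV :: 'k set)"
    and "graded_ideal n I" "codim_less n I t (mon_count (Suc s) t)"
  shows "reducible n I s t"
  using assms(2,3)
proof (induction s arbitrary: I t)
  case 0
  have "forms n t \<subseteq> I"
    using 0 by (intro codim_less_1D graded_idealD(1)) (simp_all add: One_nat_def)
  then show ?case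
    using subset_adjoin by (fastforce simp: reducible_def)
next
  case (Suc s)
  show ?case
    using Suc.prems
  proof (induction t arbitrary: I)
    case 0
    have "forms n 0 \<subseteq> I"
      using 0 by (intro codim_less_1D graded_idealD(1)) simp_all
    then show ?case
      unfolding reducible_def by (intro exI[of _ "\<lambda>_. 0"] conjI order_trans[OF _ subset_adjoin]) simp_all
  next
    case (Suc t)
    note I = graded_idealD(1)[OF Suc.prems(1)]
    let ?x = "\<lambda>i. monomial (Poly_Mapping.single i 1) :: 'k mpoly"
    have x: "?x i \<in> forms n 1" if "i < n" for i
      using that by (intro forms_monomial mons_single) simp
    show ?case
    proof (cases "\<exists>i<n. codim_less n (adjoin n I 1 (\<lambda>_. ?x i)) (Suc t) (mon_count (Suc s) (Suc t))")
      case True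
      then obtain i where i: "i < n"
        "codim_less n (adjoin n I 1 (\<lambda>_. ?x i)) (Suc t) (mon_count (Suc s) (Suc t))"
        by blast
      have "reducible n (adjoin n I 1 (\<lambda>_. ?x i)) s (Suc t)"
        using Suc.prems(1) x[OF i(1)] i(2) by (intro \<open>\<And>I t. _ \<Longrightarrow> _ \<Longrightarrow> reducible n I s t\<close> graded_adjoin_forms)
      then show ?thesis
        by (rule reducible_adjoin[OF I x[OF i(1)]])
    next
      case False
      have "codim_less n (colon n I (?x i)) t (mon_count (Suc (Suc s)) t)" if "i < n" for i
        using codim_less_adjoin_or_colon[OF I x[OF that]] False that Suc.prems(2)
        by (auto simp: mon_count_Suc[of "Suc s"])
      moreover have "graded_ideal n (colon n I (?x i))" if "i < n" for i
        using Suc.prems(1) x[OF that] by (rule graded_colon)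
      ultimately obtain z where z: "\<And>i. i < Suc s \<Longrightarrow> z i \<in> forms n 1"
        "\<And>i. i < n \<Longrightarrow> forms n t \<subseteq> adjoin n (colon n I (?x i)) (Suc s) z"
        using common_reduction[OF k finite_lessThan[of n], where I = "\<lambda>i. colon n I (?x i)"
            and t = "\<lambda>_. t" and s = "Suc s" and n = n] Suc.IH by auto
      have A: "ideal (adjoin n I (Suc s) z) (mpoly_ring n)"
        using I forms_polys[OF z(1)] by (intro ideal_adjoin)
      have "forms n (Suc t) \<subseteq> adjoin n I (Suc s) z"
      proof (rule forms_subset_idealI[OF A])
        fix a assume "a \<in> mons {..<n} (Suc t)"
        then obtain i b where b: "i \<in> {..<n}" "b \<in> mons {..<n} t" "a = Poly_Mapping.single i 1 + b"
          by (rule mons_SucE)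
        then have "monomial b \<in> adjoin n (colon n I (?x i)) (Suc s) z"
          using z(2)[of i] forms_monomial[OF b(2)] by auto
        then obtain q g where q: "q \<in> colon n I (?x i)" "\<And>i. i < Suc s \<Longrightarrow> g i \<in> polys n"
          "monomial b = q + (\<Sum>j<Suc s. z j * g j)"
          by (rule adjoinE) (rule that, assumption+)
        have "monomial a = ?x i * q + (\<Sum>j<Suc s. z j * (?x i * g j))"
          unfolding b(3) monomial_add q(3) by (simp add: distrib_left sum_distrib_left mult_ac)
        also have "\<dots> \<in> adjoin n I (Suc s) z"
          using q(1,2) x[of i] b(1) by (intro adjoinI polys_mult) (auto simp: colon_def forms_polys)
        finally show "monomial a \<in> adjoin n I (Suc s) z" .
      qed
      then show ?thesis
        using z(1) by (auto simp: reducible_def)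
    qed
  qed
qed

section \<open>Hilbert functions\<close>

lemma finite_monomial_mons: "finite S \<Longrightarrow> finite (monomial ` mons S t)"
  by (simp add: finite_mons)

lemma inj_monomial: "inj_on (monomial :: expo \<Rightarrow> 'k::field mpoly) A"
  by (auto simp: inj_on_def monomial_def dest!: arg_cong[where f = Poly_Mapping.keys])

lemma independent_monomials:
  assumes "finite A"
  shows "mp.independent (monomial ` A :: 'k::field mpoly set)"
proof (rule mp.independent_if_scalars_zero)
  fix f :: "'k mpoly \<Rightarrow> 'k" and x :: "'k mpoly" assume sum: "(\<Sum>x\<in>monomial ` A. mpoly_scale (f x) x) = 0" and "x \<in> monomial ` A"
  then obtain a where a: "a \<in> A" "x = monomial a" by blast
  have "0 = Poly_Mapping.lookup (\<Sum>b\<in>A. mpoly_scale (f (monomial b)) (monomial b)) a"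
    using sum by (simp add: sum.reindex[OF inj_monomial] o_def)
  also have "\<dots> = (\<Sum>b\<in>A. if b = a then f (monomial a) else 0)"
    unfolding lookup_sum by (intro sum.cong) (auto simp: lookup_monomial)
  also have "\<dots> = f x"
    using a assms by simp
  finally show "f x = 0" by simp
qed (use assms in simp)

lemma mpoly_in_span:
  fixes p :: "'k::field mpoly"
  assumes "Poly_Mapping.keys p \<subseteq> A"
  shows "p \<in> mp.span (monomial ` A)"
proof -
  have "(\<Sum>a\<in>Poly_Mapping.keys p. mpoly_scale (Poly_Mapping.lookup p a) (monomial a)) \<in> mp.span (monomial ` A)"
    using assms by (intro mp.span_sum mp.span_scale mp.span_base) auto
  then show ?thesis
    using mpoly_expand[of "Poly_Mapping.keys p" p] by simp
qed

lemma forms_span: "forms n t \<subseteq> mp.span (monomial ` mons {..<n} t)"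
  by (auto simp: forms_iff intro: mpoly_in_span)

lemma card_le_hilbert_function:
  fixes B :: "'k::field mpoly set"
  assumes "B \<subseteq> I \<inter> forms n t" "mp.independent B"
  shows "card B \<le> hilbert_function n I t"
proof -
  obtain C where C: "C \<subseteq> I \<inter> forms n t" "mp.independent C" "I \<inter> forms n t \<subseteq> mp.span C"
    "card C = mp.dim (I \<inter> forms n t)"
    by (rule mp.basis_exists)
  have "finite C"
    using mp.independent_span_bound[OF finite_monomial_mons C(2), of "{..<n}" t] C(1) forms_span by blast
  then show ?thesis
    using mp.independent_span_bound[OF _ assms(2), of C] assms(1) C
    by (auto simp: hilbert_function_def)
qed

text \<open>A basis of the degree \<open>t\<close> part of \<open>I\<close> together with a family that is independent modulo \<open>I\<close> is an
  independent set of forms, so that there are at most \<open>mon_count n t\<close> elements in total.\<close>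

lemma codim_less_hilbert_functionI:
  fixes I :: "'k::field mpoly set"
  assumes I: "ideal I (mpoly_ring n)" and h: "mon_count n t < hilbert_function n I t + m"
  shows "codim_less n I t m"
proof (rule ccontr)
  assume "\<not> ?thesis"
  then obtain f :: "nat \<Rightarrow> 'k mpoly"
    where f: "\<And>i. i < m \<Longrightarrow> f i \<in> forms n t" "indep_mod I f m"
    by (auto simp: codim_less_def)
  obtain B where B: "B \<subseteq> I \<inter> forms n t" "mp.independent B" "card B = mp.dim (I \<inter> forms n t)"
    by (rule mp.basis_exists) (rule that, assumption+)
  have finB: "finite B"
    using mp.independent_span_bound[OF finite_monomial_mons B(2), of "{..<n}" t] B(1) forms_span by blast
  have f0: "u i = 0" if "(\<Sum>i<m. mpoly_scale (u i) (f i)) \<in> I" "i < m" for u i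
    using f(2) that by (auto simp: indep_mod_def)
  have inj: "inj_on f {..<m}"
  proof (rule inj_onI)
    fix i j assume ij: "i \<in> {..<m}" "j \<in> {..<m}" "f i = f j"
    show "i = j"
    proof (rule ccontr)
      assume "i \<noteq> j"
      let ?u = "\<lambda>l. (if l = i then 1 else 0) - (if l = j then 1 else 0) :: 'k"
      have "(\<Sum>l<m. mpoly_scale (?u l) (f l))
          = (\<Sum>l<m. if l = i then f l else 0) - (\<Sum>l<m. if l = j then f l else 0)"
        unfolding sum_subtractf[symmetric] by (intro sum.cong) (auto simp: mp.scale_left_diff_distrib)
      also have "\<dots> = 0"
        using ij by simp
      finally show False
        using f0[of ?u i] ij \<open>i \<noteq> j\<close> ideal_mpolyD(2)[OF I] by simp
    qed
  qed
  have fI: "f i \<notin> I" if "i < m" for i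
  proof
    assume "f i \<in> I"
    moreover have "(\<Sum>l<m. mpoly_scale (if l = i then 1 else 0) (f l)) = (\<Sum>l<m. if l = i then f l else 0)"
      by (intro sum.cong) auto
    ultimately show False
      using f0[of "\<lambda>l. if l = i then 1 else 0" i] that by simp
  qed
  have disj: "B \<inter> f ` {..<m} = {}"
    using fI B(1) by auto
  have "mp.independent (B \<union> f ` {..<m})"
  proof (rule mp.independent_if_scalars_zero)
    show "finite (B \<union> f ` {..<m})" using finB by simp
    fix c x assume "(\<Sum>x\<in>B \<union> f ` {..<m}. mpoly_scale (c x) x) = 0" and x: "x \<in> B \<union> f ` {..<m}"
    then have sum: "(\<Sum>x\<in>B. mpoly_scale (c x) x) + (\<Sum>i<m. mpoly_scale (c (f i)) (f i)) = 0"
      using finB disj by (simp add: sum.union_disjoint sum.reindex[OF inj] o_def)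
    have "(\<Sum>x\<in>B. mpoly_scale (c x) x) \<in> I"
      using B(1) by (intro ideal_mpoly_sum[OF I] ideal_mpolyD(6)[OF I]) auto
    moreover have "(\<Sum>i<m. mpoly_scale (c (f i)) (f i)) = - (\<Sum>x\<in>B. mpoly_scale (c x) x)"
      using sum by (simp add: eq_neg_iff_add_eq_0 add.commute)
    ultimately have "(\<Sum>i<m. mpoly_scale (c (f i)) (f i)) \<in> I"
      using ideal_mpoly_uminus[OF I] by simp
    then have cf: "c (f i) = 0" if "i < m" for i
      using f0[of "\<lambda>i. c (f i)"] that by blast
    with sum have "(\<Sum>x\<in>B. mpoly_scale (c x) x) = 0"
      by simp
    then have "c y = 0" if "y \<in> B" for y
      using B(2) finB that unfolding mp.independent_explicit_finite_subsets by blast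
    with cf x show "c x = 0" by auto
  qed
  moreover have "B \<union> f ` {..<m} \<subseteq> mp.span (monomial ` mons {..<n} t)"
    using B(1) f(1) forms_span by blast
  ultimately have "card (B \<union> f ` {..<m}) \<le> card (monomial ` mons {..<n} t :: 'k mpoly set)"
    using mp.independent_span_bound finite_monomial_mons by blast
  also have "\<dots> = mon_count n t"
    by (simp add: card_image[OF inj_monomial] card_mons)
  also have "card (B \<union> f ` {..<m}) = hilbert_function n I t + m"
    using disj finB inj B(3) by (simp add: card_Un_disjoint card_image hilbert_function_def)
  finally show False
    using h by simp
qed

lemma mon_count_le_hilbert_function_plus:
  fixes I G :: "'k::field mpoly set"
  assumes I: "ideal I (mpoly_ring n)" and G: "finite G" "G \<subseteq> forms n t"
    and sub: "\<And>p. p \<in> forms n t \<Longrightarrow> \<exists>w\<in>mp.span G. p - w \<in> I"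
  shows "mon_count n t \<le> hilbert_function n I t + card G"
proof -
  obtain B where B: "B \<subseteq> I \<inter> forms n t" "mp.independent B" "I \<inter> forms n t \<subseteq> mp.span B"
    "card B = mp.dim (I \<inter> forms n t)"
    by (rule mp.basis_exists)
  have finB: "finite B"
    using mp.independent_span_bound[OF finite_monomial_mons B(2), of "{..<n}" t] B(1) forms_span by blast
  have sp: "mp.span G \<subseteq> forms n t"
    using G(2) by (intro mp.span_minimal) (auto simp: mp.subspace_def forms_add forms_scale)
  have "monomial ` mons {..<n} t \<subseteq> mp.span (B \<union> G)"
  proof
    fix p :: "'k mpoly" assume "p \<in> monomial ` mons {..<n} t"
    then have p: "p \<in> forms n t"
      using forms_monomial by blast
    then obtain w where w: "w \<in> mp.span G" "p - w \<in> I"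
      using sub by blast
    have "w \<in> forms n t" using w(1) sp by blast
    then have "p - w \<in> forms n t"
      using forms_add[OF p forms_scale[of w n t "- 1"]] by (simp add: mp.scale_minus_left)
    with w(2) B(3) have "p - w \<in> mp.span B" by blast
    then have "w + (p - w) \<in> mp.span (B \<union> G)"
      using w(1) by (intro mp.span_add) (auto intro: subsetD[OF mp.span_mono, rotated])
    then show "p \<in> mp.span (B \<union> G)" by simp
  qed
  then have "card (monomial ` mons {..<n} t :: 'k mpoly set) \<le> card (B \<union> G)"
    using mp.independent_span_bound[of "B \<union> G", OF _ independent_monomials[OF finite_mons]] finB G(1)
    by simp
  also have "\<dots> \<le> card B + card G"
    by (rule card_Un_le)
  finally show ?thesis
    by (simp add: card_image[OF inj_monomial] card_mons B(4) hilbert_function_def)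
qed

definition power_product :: "nat \<Rightarrow> (nat \<Rightarrow> 'k::field mpoly) \<Rightarrow> expo \<Rightarrow> 'k mpoly" where
  "power_product s z a = (\<Prod>i<s. z i ^ Poly_Mapping.lookup a i)"

lemma power_product_add_single:
  assumes "i < s"
  shows "power_product s z (Poly_Mapping.single i 1 + a) = z i * power_product s z a"
proof -
  have "power_product s z (Poly_Mapping.single i 1 + a)
      = (\<Prod>j<s. (if j = i then z j else 1) * z j ^ Poly_Mapping.lookup a j)"
    unfolding power_product_def
    by (intro prod.cong) (auto simp: lookup_add lookup_single when_def power_add)
  also have "\<dots> = z i * power_product s z a"
    unfolding prod.distrib power_product_def using assms by simp
  finally show ?thesis .
qed

lemma one_in_forms: "(1 :: 'k::field mpoly) \<in> forms n 0"
  by (simp add: forms_iff)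

lemma forms_power: "p \<in> forms n t \<Longrightarrow> p ^ k \<in> forms n (k * t)" for p :: "'k::field mpoly"
  by (induction k) (auto simp: one_in_forms dest: forms_mult)

lemma forms_power_product:
  assumes "\<And>i. i < s \<Longrightarrow> z i \<in> forms n 1" "a \<in> mons {..<s} k"
  shows "power_product s z a \<in> forms n k"
proof -
  have "(\<Prod>i<r. z i ^ Poly_Mapping.lookup a i) \<in> forms n (\<Sum>i<r. Poly_Mapping.lookup a i)" if "r \<le> s" for r
    using that
  proof (induction r)
    case (Suc r)
    then show ?case
      using forms_mult[OF Suc.IH forms_power[OF assms(1)[of r], of "Poly_Mapping.lookup a r"]] by simp
  qed (simp add: one_in_forms)
  from this[of s] show ?thesis
    using assms(2) expo_deg_superset[of "{..<s}" a] by (simp add: mons_def power_product_def)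
qed

text \<open>A converse of the Eakin-Sathaye theorem for some large degree: if \<open>s\<close> linear forms \<open>z\<close> generate
  \<open>R/I\<close> from some degree \<open>t\<close> on, then \<open>R/I\<close> is spanned in degree \<open>t + k\<close> by the products of power products
  of degree \<open>k\<close> in the \<open>z i\<close> with monomials of degree \<open>t\<close>.  Their number grows like that of the monomials
  of degree \<open>k\<close> in only \<open>s\<close> variables.\<close>

lemma reducible_imp_hilbert_function_large:
  fixes I :: "'k::field mpoly set"
  assumes I: "graded_ideal n I" and red: "reducible n I s t"
  shows "\<exists>u. mon_count n u < hilbert_function n I u + mon_count (Suc s) u"
proof -
  obtain z where z: "\<And>i. i < s \<Longrightarrow> z i \<in> forms n 1" "forms n t \<subseteq> adjoin n I s z"
    using red by (auto simp: reducible_def)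
  note I' = graded_idealD(1)[OF I]
  have A: "ideal (adjoin n I s z) (mpoly_ring n)"
    using I' forms_polys[OF z(1)] by (intro ideal_adjoin)
  define G where "G k = (\<lambda>(a, b). power_product s z a * monomial b) ` (mons {..<s} k \<times> mons {..<n} t)" for k
  have finG: "finite (G k)" for k
    by (simp add: G_def finite_mons)
  have G_forms: "G k \<subseteq> forms n (t + k)" for k
  proof -
    have "power_product s z a * monomial b \<in> forms n (k + t)"
      if "a \<in> mons {..<s} k" "b \<in> mons {..<n} t" for a b
      using z(1) that by (intro forms_mult forms_power_product forms_monomial)
    then show ?thesis
      by (auto simp: G_def add.commute)
  qed
  have card_G: "card (G k) \<le> mon_count n t * mon_count s k" for k
    unfolding G_def using card_image_le[of "mons {..<s} k \<times> mons {..<n} t"]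
    by (simp add: finite_mons card_mons card_cartesian_product mult.commute)
  have mult_G: "z i * w \<in> mp.span (G (Suc k))" if "i < s" "w \<in> mp.span (G k)" for i w k
    using that(2)
  proof (induction rule: mp.span_induct)
    case base
    show ?case
      by (auto simp: mp.subspace_def distrib_left scale_mult_right mp.span_zero mp.span_add mp.span_scale)
  next
    case (step w)
    then obtain a b where ab: "a \<in> mons {..<s} k" "b \<in> mons {..<n} t" "w = power_product s z a * monomial b"
      by (auto simp: G_def)
    have "z i * w = power_product s z (Poly_Mapping.single i 1 + a) * monomial b"
      using that(1) by (simp add: ab(3) power_product_add_single mult.assoc)
    moreover have "Poly_Mapping.single i 1 + a \<in> mons {..<s} (Suc k)"
      using mons_add[OF mons_single[of i "{..<s}" 1] ab(1)] that(1)
      by (simp flip: Suc_eq_plus1_left)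
    ultimately show ?case
      using ab(2) by (intro mp.span_base) (auto simp: G_def)
  qed
  have span: "\<exists>w\<in>mp.span (G k). p - w \<in> I" if "p \<in> forms n (t + k)" for p k
    using that
  proof (induction k arbitrary: p)
    case 0
    have "monomial ` mons {..<n} t \<subseteq> G 0"
      by (auto simp: G_def power_product_def image_iff)
    from subsetD[OF mp.span_mono[OF this]] have "p \<in> mp.span (G 0)"
      using 0 forms_span[of n t] by auto
    then show ?case
      using ideal_mpolyD(2)[OF I'] by (intro bexI[of _ p]) auto
  next
    case (Suc k)
    have "p \<in> adjoin n I s z"
      using forms_subset_ideal_mono[OF A z(2), of "t + Suc k"] Suc.prems by auto
    then obtain q g where q: "q \<in> I" "q \<in> forms n (t + Suc k)" "\<And>i. g i \<in> forms n (t + Suc k - 1)" "p = q + (\<Sum>i<s. z i * g i)"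
      by (rule adjoin_homogeneous_cofactors[OF I _ _ Suc.prems, rotated]) (rule that, assumption+, rule z, assumption)
    have "\<forall>i. \<exists>w\<in>mp.span (G k). g i - w \<in> I"
      using q(3) by (intro allI Suc.IH) simp
    then obtain w where w: "\<And>i. w i \<in> mp.span (G k)" "\<And>i. g i - w i \<in> I"
      by metis
    show ?case
    proof (rule bexI[of _ "\<Sum>i<s. z i * w i"])
      have "p - (\<Sum>i<s. z i * w i) = q + (\<Sum>i<s. z i * (g i - w i))"
        unfolding q(4) by (simp add: right_diff_distrib sum_subtractf)
      also have "\<dots> \<in> I"
        using w(2) forms_polys[OF z(1)]
        by (intro ideal_mpolyD(3)[OF I'] ideal_mpoly_sum[OF I'] ideal_mpolyD(4)[OF I'] q(1)) auto
      finally show "p - (\<Sum>i<s. z i * w i) \<in> I" .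
      show "(\<Sum>i<s. z i * w i) \<in> mp.span (G (Suc k))"
        using w(1) by (intro mp.span_sum mult_G) auto
    qed
  qed
  obtain k where "mon_count n t * mon_count s k < mon_count (Suc s) (t + k)"
    using mon_count_dominates by blast
  moreover have "mon_count n (t + k) \<le> hilbert_function n I (t + k) + card (G k)"
    using I' finG G_forms span by (rule mon_count_le_hilbert_function_plus)
  ultimately show ?thesis
    using card_G[of k] by (intro exI[of _ "t + k"]) linarith
qed

section \<open>Lex-segment ideals\<close>

text \<open>The ideal generated by the first \<open>j\<close> variables.\<close>

definition low_ideal :: "nat \<Rightarrow> nat \<Rightarrow> 'k::field mpoly set" where
  "low_ideal n j = {p \<in> polys n. \<forall>a\<in>Poly_Mapping.keys p. \<exists>i<j. Poly_Mapping.lookup a i \<noteq> 0}"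

lemma graded_low_ideal: "graded_ideal n (low_ideal n j :: 'k::field mpoly set)"
  unfolding graded_ideal_def ideal_mpoly_iff
proof (intro conjI ballI allI)
  show "(low_ideal n j :: 'k mpoly set) \<subseteq> polys n" "0 \<in> (low_ideal n j :: 'k mpoly set)"
    by (auto simp: low_ideal_def)
  show "p + q \<in> low_ideal n j" if "p \<in> low_ideal n j" "q \<in> low_ideal n j" for p q :: "'k mpoly"
    using that Poly_Mapping.keys_add[of p q] by (auto simp: low_ideal_def polys_add)
  show "r * p \<in> low_ideal n j" if "p \<in> low_ideal n j" "r \<in> polys n" for p r :: "'k mpoly"
    using that Poly_Mapping.keys_mult[of r p]
    by (fastforce simp: low_ideal_def polys_mult lookup_add)
  show "part t p \<in> low_ideal n j" if "p \<in> low_ideal n j" for p :: "'k mpoly" and t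
    using that by (auto simp: low_ideal_def part_polys in_keys_iff lookup_part split: if_splits)
qed

lemma card_low_mons:
  assumes "j \<le> n"
  shows "card {a \<in> mons {..<n} t. \<exists>i<j. Poly_Mapping.lookup a i \<noteq> 0} + mon_count (n - j) t
    = mon_count n t"
proof -
  let ?L = "{a \<in> mons {..<n} t. \<exists>i<j. Poly_Mapping.lookup a i \<noteq> 0}"
  have "(\<exists>i<j. Poly_Mapping.lookup a i \<noteq> 0) \<longleftrightarrow> \<not> Poly_Mapping.keys a \<subseteq> {j..}" for a :: expo
    by (auto simp: in_keys_iff subset_iff not_le)
  moreover have "mons {j..<n} t = {a \<in> mons {..<n} t. Poly_Mapping.keys a \<subseteq> {j..}}"
    by (auto simp: mons_def)
  ultimately have un: "mons {..<n} t = ?L \<union> mons {j..<n} t" and disj: "?L \<inter> mons {j..<n} t = {}"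
    by auto
  have "card (mons {..<n} t) = card ?L + card (mons {j..<n} t)"
    by (subst un, rule card_Un_disjoint[OF _ _ disj]) (simp_all add: finite_mons)
  then show ?thesis
    by (simp add: card_mons)
qed

lemma hilbert_function_le_low:
  fixes I :: "'k::field mpoly set"
  assumes "I \<inter> forms n t \<subseteq> low_ideal n j" "j \<le> n"
  shows "hilbert_function n I t + mon_count (n - j) t \<le> mon_count n t"
proof -
  let ?L = "{a \<in> mons {..<n} t. \<exists>i<j. Poly_Mapping.lookup a i \<noteq> 0}"
  have "I \<inter> forms n t \<subseteq> mp.span (monomial ` ?L)"
  proof
    fix p assume p: "p \<in> I \<inter> forms n t"
    with assms(1) have "Poly_Mapping.keys p \<subseteq> ?L"
      by (auto simp: low_ideal_def forms_iff)
    then show "p \<in> mp.span (monomial ` ?L)"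
      by (rule mpoly_in_span)
  qed
  then have "hilbert_function n I t \<le> card (monomial ` ?L :: 'k mpoly set)"
    unfolding hilbert_function_def by (rule mp.dim_le_card) (simp add: finite_mons)
  also have "\<dots> = card ?L"
    by (rule card_image[OF inj_monomial])
  finally show ?thesis
    using card_low_mons[OF assms(2), of t] by linarith
qed

lemma monomial_ideal_homogeneous:
  fixes J :: "'k::field mpoly set"
  assumes "monomial_ideal n J"
  shows "homogeneous_ideal n J"
proof -
  obtain E where E: "E \<subseteq> expos n" "J = genideal (mpoly_ring n) (monomial ` E)"
    using assms by (auto simp: monomial_ideal_def)
  have "monomial ` E \<subseteq> (\<Union>t. forms n t :: 'k mpoly set)"
    using E(1) forms_monomial[OF expos_mons] by blast
  with E(2) show ?thesis
    by (auto simp: homogeneous_ideal_def)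
qed

lemma monomial_ideal_keys:
  fixes J :: "'k::field mpoly set"
  assumes J: "monomial_ideal n J" and p: "p \<in> J" "a \<in> Poly_Mapping.keys p"
  shows "monomial a \<in> J"
proof -
  interpret R: cring "mpoly_ring n :: 'k mpoly ring" by (rule cring_mpoly_ring)
  obtain E where E: "E \<subseteq> expos n" "J = genideal (mpoly_ring n) (monomial ` E)"
    using J by (auto simp: monomial_ideal_def)
  have Ep: "monomial ` E \<subseteq> (polys n :: 'k mpoly set)"
    using E(1) polys_monomial by blast
  have I: "ideal J (mpoly_ring n)"
    unfolding E(2) using Ep by (rule R.genideal_ideal)
  let ?J = "{p \<in> J. \<forall>a\<in>Poly_Mapping.keys p. monomial a \<in> J}"
  have "ideal ?J (mpoly_ring n)"
    unfolding ideal_mpoly_iff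
  proof (intro conjI ballI)
    show "?J \<subseteq> polys n" "0 \<in> ?J"
      using ideal_mpolyD[OF I] by auto
    show "p + q \<in> ?J" if "p \<in> ?J" "q \<in> ?J" for p q
      using that ideal_mpolyD(3)[OF I] Poly_Mapping.keys_add[of p q] by auto
    show "r * p \<in> ?J" if p: "p \<in> ?J" and r: "r \<in> polys n" for p r
    proof -
      have "monomial c \<in> J" if c: "c \<in> Poly_Mapping.keys (r * p)" for c
      proof -
        obtain a b where ab: "c = a + b" "a \<in> Poly_Mapping.keys r" "b \<in> Poly_Mapping.keys p"
          using subsetD[OF Poly_Mapping.keys_mult c] by auto
        then have "monomial b \<in> J" "monomial a \<in> (polys n :: 'k mpoly set)"
          using p r polys_monomial by (auto simp: polys_iff)
        then show ?thesis
          unfolding ab(1) monomial_add by (rule ideal_mpolyD(4)[OF I])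
      qed
      then show ?thesis
        using p r ideal_mpolyD(4)[OF I] by auto
    qed
  qed
  moreover have "monomial ` E \<subseteq> ?J"
    using R.genideal_self[OF Ep] E(2) by (auto simp: monomial_def)
  ultimately have "J \<subseteq> ?J"
    unfolding E(2) by (rule R.genideal_minimal)
  with p show ?thesis by blast
qed

text \<open>The power \<open>x\<^sub>j\<^sup>t\<close> is the largest monomial of degree \<open>t\<close> that does not involve any of the first \<open>j\<close>
  variables.\<close>

lemma lex_segment_subset_low:
  fixes J :: "'k::field mpoly set"
  assumes J: "lex_segment_ideal n J" and j: "j < n" and x: "monomial (Poly_Mapping.single j t) \<notin> J"
  shows "J \<inter> forms n t \<subseteq> low_ideal n j"
proof
  fix p assume p: "p \<in> J \<inter> forms n t"
  have "\<exists>i<j. Poly_Mapping.lookup a i \<noteq> 0" if a: "a \<in> Poly_Mapping.keys p" for a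
  proof (rule ccontr)
    assume high: "\<not> ?thesis"
    have am: "a \<in> mons {..<n} t"
      using p a by (auto simp: forms_iff)
    have le: "a \<le> Poly_Mapping.single j t"
    proof (cases "Poly_Mapping.lookup a j = t")
      case True
      have "Poly_Mapping.lookup a i = 0" if "i \<noteq> j" for i
      proof -
        have "Poly_Mapping.lookup a i + Poly_Mapping.lookup a j
            \<le> (\<Sum>l\<in>insert i (insert j (Poly_Mapping.keys a)). Poly_Mapping.lookup a l)"
          using that by (subst sum.remove[of _ i], simp, simp, subst sum.remove[of _ j]) auto
        also have "\<dots> = expo_deg a"
          by (intro expo_deg_superset[symmetric]) auto
        finally show ?thesis
          using True am by (simp add: mons_def)
      qed
      then have "a = Poly_Mapping.single j t"
        using True by (intro poly_mapping_eqI) (auto simp: lookup_single when_def)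
      then show ?thesis by simp
    next
      case False
      then have "Poly_Mapping.lookup a j < t"
        using lookup_le_expo_deg[of a j] am by (simp add: mons_def)
      then have "a < Poly_Mapping.single j t"
        unfolding expo_less_iff using high by (intro exI[of _ j]) (auto simp: lookup_single)
      then show ?thesis by simp
    qed
    have "monomial a \<in> J"
      using J p a monomial_ideal_keys by (auto simp: lex_segment_ideal_def)
    moreover have "a \<in> expos n" "Poly_Mapping.single j t \<in> expos n" "expo_deg a = t"
      using am j by (auto simp: mons_def expos_def)
    ultimately show False
      using J le x unfolding lex_segment_ideal_def by (metis expo_deg_single)
  qed
  then show "p \<in> low_ideal n j"
    using p forms_polys by (auto simp: low_ideal_def)
qed

text \<open>Every monomial of degree \<open>t\<close> that involves one of the first \<open>j\<close> variables is larger than \<open>x\<^sub>j\<^sup>t\<close>.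
  Hence \<open>J\<close> contains all of these and one monomial more.\<close>

lemma lex_segment_hilbert_function_large:
  fixes J :: "'k::field mpoly set"
  assumes J: "lex_segment_ideal n J" and j: "j < n" and x: "monomial (Poly_Mapping.single j t) \<in> J"
  shows "mon_count n t < hilbert_function n J t + mon_count (n - j) t"
proof -
  let ?L = "{a \<in> mons {..<n} t. \<exists>i<j. Poly_Mapping.lookup a i \<noteq> 0}"
  let ?a = "Poly_Mapping.single j t"
  have mem: "monomial a \<in> J \<inter> forms n t" if "a \<in> insert ?a ?L" for a
  proof
    have am: "a \<in> mons {..<n} t"
      using that j by (auto intro: mons_single)
    then show "monomial a \<in> forms n t"
      by (rule forms_monomial)
    have "?a \<le> a"
    proof (cases "a = ?a")
      case False
      with that obtain i0 where i0: "i0 < j" "Poly_Mapping.lookup a i0 \<noteq> 0" by blast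
      define i where "i = (LEAST i. Poly_Mapping.lookup a i \<noteq> 0)"
      have i: "Poly_Mapping.lookup a i \<noteq> 0" "i \<le> i0"
        unfolding i_def using i0(2)
        by (rule LeastI[of "\<lambda>i. Poly_Mapping.lookup a i \<noteq> 0"], rule Least_le[of "\<lambda>i. Poly_Mapping.lookup a i \<noteq> 0"])
      have i': "Poly_Mapping.lookup a l = 0" if "l < i" for l
        using not_less_Least[of l "\<lambda>i. Poly_Mapping.lookup a i \<noteq> 0"] that by (simp add: i_def)
      have "i < j"
        using i(2) i0(1) by (rule le_less_trans)
      with i i' have "?a < a"
        unfolding expo_less_iff by (intro exI[of _ i]) (auto simp: lookup_single)
      then show ?thesis by simp
    qed simp
    moreover have "a \<in> expos n" "?a \<in> expos n" "expo_deg a = t"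
      using am j by (auto simp: mons_def expos_def)
    ultimately show "monomial a \<in> J"
      using J x unfolding lex_segment_ideal_def by (metis expo_deg_single)
  qed
  have fin: "finite ?L"
    by (simp add: finite_mons)
  have "Suc (card ?L) = card (insert ?a ?L)"
    using fin by (subst card_insert_disjoint) (auto simp: lookup_single)
  also have "\<dots> = card (monomial ` insert ?a ?L :: 'k mpoly set)"
    by (rule card_image[OF inj_monomial, symmetric])
  also have "\<dots> \<le> hilbert_function n J t"
  proof (rule card_le_hilbert_function)
    show "monomial ` insert ?a ?L \<subseteq> J \<inter> forms n t"
      using mem by blast
    show "mp.independent (monomial ` insert ?a ?L :: 'k mpoly set)"
      using fin by (intro independent_monomials finite.insertI)
  qed
  finally show ?thesis
    using card_low_mons[of j n t] j by linarith
qed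

text \<open>For lex-segment ideals the numerical condition of the Eakin-Sathaye theorem is also necessary,
  in every degree.  If it fails in degree \<open>t\<close>, then \<open>x\<^sub>j\<^sup>t \<notin> J\<close> for \<open>j = n - s - 1\<close>, so that the part of \<open>J\<close>
  of degree \<open>t\<close> lies in the ideal of the first \<open>j\<close> variables.  The quotient by the latter is a polynomial
  ring in \<open>s + 1\<close> variables, which \<open>s\<close> linear forms do not generate in any degree.\<close>

lemma lex_segment_reducible_imp_large:
  fixes J :: "'k::field mpoly set"
  assumes J: "lex_segment_ideal n J" and s: "s < n" and red: "reducible n J s t"
  shows "mon_count n t < hilbert_function n J t + mon_count (Suc s) t"
proof (rule ccontr)
  assume *: "\<not> ?thesis"
  define j where "j = n - Suc s"
  have j: "j < n" "n - j = Suc s"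
    using s by (auto simp: j_def)
  have "monomial (Poly_Mapping.single j t) \<notin> J"
    using lex_segment_hilbert_function_large[OF J j(1), of t] * j(2) by auto
  then have low: "J \<inter> forms n t \<subseteq> low_ideal n j"
    by (rule lex_segment_subset_low[OF J j(1)])
  have JG: "graded_ideal n J"
    using J by (intro homogeneous_imp_graded monomial_ideal_homogeneous) (simp add: lex_segment_ideal_def)
  obtain z where z: "\<And>i. i < s \<Longrightarrow> z i \<in> forms n 1" "forms n t \<subseteq> adjoin n J s z"
    using red by (auto simp: reducible_def)
  have "forms n t \<subseteq> adjoin n (low_ideal n j) s z"
  proof
    fix p :: "'k mpoly" assume p: "p \<in> forms n t"
    with z(2) have "p \<in> adjoin n J s z" by blast
    then obtain q g where "q \<in> J" "q \<in> forms n t" "\<And>i. g i \<in> forms n (t - 1)" "p = q + (\<Sum>i<s. z i * g i)"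
      by (rule adjoin_homogeneous_cofactors[OF JG _ _ p, rotated]) (rule that, assumption+, rule z, assumption)
    then show "p \<in> adjoin n (low_ideal n j) s z"
      using low by (auto intro!: adjoinI intro: forms_polys)
  qed
  then have "reducible n (low_ideal n j :: 'k mpoly set) s t"
    using z(1) by (auto simp: reducible_def)
  from reducible_imp_hilbert_function_large[OF graded_low_ideal this]
  obtain u where "mon_count n u < hilbert_function n (low_ideal n j :: 'k mpoly set) u + mon_count (Suc s) u"
    by blast
  moreover have "hilbert_function n (low_ideal n j :: 'k mpoly set) u + mon_count (n - j) u \<le> mon_count n u"
    using j(1) by (intro hilbert_function_le_low) auto
  ultimately show False
    using j(2) by simp
qed

section \<open>Krull dimension\<close>

lemma part_mult_top:
  fixes p q :: "'k::field mpoly"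
  assumes p: "p \<in> polys n" "\<And>t. t > a \<Longrightarrow> part t p = 0"
    and q: "q \<in> polys n" "\<And>t. t > b \<Longrightarrow> part t q = 0"
  shows "part (a + b) (p * q) = part a p * part b q"
proof -
  have expand: "r = (\<Sum>t\<le>c. part t r)" if "\<And>t. t > c \<Longrightarrow> part t r = 0" for r :: "'k mpoly" and c
  proof (rule sum_parts, rule ccontr)
    fix e assume e: "e \<in> Poly_Mapping.keys r" "\<not> expo_deg e \<le> c"
    then have "Poly_Mapping.lookup (part (expo_deg e) r) e = 0"
      using that[of "expo_deg e"] by simp
    with e show False
      by (simp add: lookup_part in_keys_iff)
  qed
  have "p * q = (\<Sum>i\<le>a. \<Sum>j\<le>b. part i p * part j q)"
    by (subst expand[OF p(2)], assumption, subst expand[OF q(2)], assumption) (simp add: sum_product)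
  then have "part (a + b) (p * q) = (\<Sum>i\<le>a. \<Sum>j\<le>b. part (a + b) (part i p * part j q))"
    by (simp add: part_sum)
  also have "\<dots> = (\<Sum>i\<le>a. \<Sum>j\<le>b. if i = a then if j = b then part a p * part b q else 0 else 0)"
    using part_forms[OF forms_mult[OF part_in_forms[OF p(1)] part_in_forms[OF q(1)]]]
    by (intro sum.cong refl) auto
  also have "\<dots> = (\<Sum>i\<le>a. if i = a then part a p * part b q else 0)"
    by (intro sum.cong refl) auto
  also have "\<dots> = part a p * part b q"
    by simp
  finally show ?thesis .
qed

text \<open>Discarding the parts above the largest degree \<open>a\<close> in which the part is not in \<open>Q\<close> changes \<open>p\<close> by an
  element of \<open>Q\<close>.  Applied to both factors of a product this reduces primality to forms.\<close>

lemma truncate_mod_graded_ideal: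
  fixes p :: "'k::field mpoly"
  assumes Q: "graded_ideal n Q" and p: "p \<in> polys n" "p \<notin> Q"
  obtains a r where "r \<in> polys n" "p - r \<in> Q" "part a r \<notin> Q" "\<And>t. t > a \<Longrightarrow> part t r = 0"
proof -
  note Q' = graded_idealD(1)[OF Q]
  define N where "N = Max (expo_deg ` Poly_Mapping.keys p)"
  have sum: "p = (\<Sum>t\<le>N. part t p)"
    by (rule sum_parts) (simp add: N_def)
  let ?A = "{t. t \<le> N \<and> part t p \<notin> Q}"
  have "?A \<noteq> {}"
  proof
    assume "?A = {}"
    then have "(\<Sum>t\<le>N. part t p) \<in> Q"
      by (intro ideal_mpoly_sum[OF Q']) auto
    with sum p(2) show False by simp
  qed
  moreover have fin: "finite ?A" by simp
  ultimately have a: "Max ?A \<in> ?A"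
    by (rule Max_in[rotated])
  define a where "a = Max ?A"
  define r where "r = (\<Sum>t\<le>a. part t p)"
  have "a \<le> N" using a by (simp add: a_def)
  have part_r: "part t r = (if t \<le> a then part t p else 0)" for t
  proof -
    have "part t r = (\<Sum>u\<le>a. if t = u then part t p else 0)"
      unfolding r_def part_sum by (intro sum.cong refl) (auto simp: part_forms[OF part_in_forms[OF p(1)]])
    then show ?thesis by simp
  qed
  have "p - r = (\<Sum>t\<in>{..N} - {..a}. part t p)"
    using \<open>a \<le> N\<close> by (subst sum) (simp add: r_def sum_diff)
  also have "\<dots> \<in> Q"
  proof (rule ideal_mpoly_sum[OF Q'])
    fix t assume "t \<in> {..N} - {..a}"
    then show "part t p \<in> Q"
      using Max_ge[OF fin, of t] by (auto simp: a_def)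
  qed
  finally have "p - r \<in> Q" .
  moreover have "r \<in> polys n"
    unfolding r_def using p(1) by (intro polys_sum part_polys)
  ultimately show thesis
    using a by (intro that[of r a]) (auto simp: part_r a_def)
qed

lemma graded_primeI:
  fixes Q :: "'k::field mpoly set"
  assumes Q: "graded_ideal n Q" and proper: "Q \<noteq> polys n"
    and prime: "\<And>d e f g. f \<in> forms n d \<Longrightarrow> g \<in> forms n e \<Longrightarrow> f * g \<in> Q \<Longrightarrow> f \<in> Q \<or> g \<in> Q"
  shows "primeideal Q (mpoly_ring n)"
proof (rule primeidealI)
  note Q' = graded_idealD(1)[OF Q]
  show "ideal Q (mpoly_ring n)" "cring (mpoly_ring n :: 'k mpoly ring)" "polys n \<noteq> Q"
    using Q' cring_mpoly_ring proper by auto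
  fix p q :: "'k mpoly"
  assume p: "p \<in> polys n" and q: "q \<in> polys n" and "p \<otimes>\<^bsub>mpoly_ring n\<^esub> q \<in> Q"
  then have pq: "p * q \<in> Q" by simp
  show "p \<in> Q \<or> q \<in> Q"
  proof (rule ccontr)
    assume "\<not> ?thesis"
    then have "p \<notin> Q" "q \<notin> Q" by auto
    obtain a r where r: "r \<in> polys n" "p - r \<in> Q" "part a r \<notin> Q" "\<And>t. t > a \<Longrightarrow> part t r = 0"
      by (rule truncate_mod_graded_ideal[OF Q p \<open>p \<notin> Q\<close>]) (rule that, assumption+)
    obtain b u where u: "u \<in> polys n" "q - u \<in> Q" "part b u \<notin> Q" "\<And>t. t > b \<Longrightarrow> part t u = 0"
      by (rule truncate_mod_graded_ideal[OF Q q \<open>q \<notin> Q\<close>]) (rule that, assumption+)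
    have "p * q - (p - r) * q - r * (q - u) \<in> Q"
      by (rule ideal_mpoly_diff[OF Q' ideal_mpoly_diff[OF Q' pq ideal_mpolyD(5)[OF Q' r(2) q]]
            ideal_mpolyD(4)[OF Q' u(2) r(1)]])
    then have "r * u \<in> Q"
      by (simp add: algebra_simps)
    then have "part (a + b) (r * u) \<in> Q"
      by (rule graded_idealD(2)[OF Q])
    then have "part a r * part b u \<in> Q"
      using part_mult_top[OF r(1,4) u(1,4)] by simp
    then show False
      using prime[OF part_in_forms[OF r(1)] part_in_forms[OF u(1)]] r(3) u(3) by blast
  qed
qed

lemma graded_ideal_Union_chain:
  assumes chain: "subset.chain {Q. graded_ideal n Q} C" and "C \<noteq> {}"
  shows "graded_ideal n (\<Union>C)"
proof -
  have G: "graded_ideal n Q" if "Q \<in> C" for Q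
    using chain that by (auto simp: subset.chain_def)
  have "\<exists>B\<in>C. p \<in> B \<and> q \<in> B" if "p \<in> \<Union>C" "q \<in> \<Union>C" for p q
    using finite_subset_Union_chain[of "{p, q}", OF _ _ \<open>C \<noteq> {}\<close> chain] that by auto
  then have add: "p + q \<in> \<Union>C" if "p \<in> \<Union>C" "q \<in> \<Union>C" for p q
    using that ideal_mpolyD(3)[OF graded_idealD(1)[OF G]] by (metis UnionI)
  show ?thesis
    unfolding graded_ideal_def ideal_mpoly_iff
  proof (intro conjI ballI allI add)
    show "\<Union>C \<subseteq> polys n"
      using ideal_mpolyD(1)[OF graded_idealD(1)[OF G]] by blast
    show "0 \<in> \<Union>C"
      using ideal_mpolyD(2)[OF graded_idealD(1)[OF G]] \<open>C \<noteq> {}\<close> by blast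
    show "r * p \<in> \<Union>C" if "p \<in> \<Union>C" "r \<in> polys n" for r p
      using that ideal_mpolyD(4)[OF graded_idealD(1)[OF G]] by blast
    show "part t p \<in> \<Union>C" if "p \<in> \<Union>C" for t p
      using that graded_idealD(2)[OF G] by blast
  qed
qed

text \<open>Zorn's lemma applies because being generated in a given degree by given linear forms is witnessed
  by finitely many elements of the ideal.\<close>

lemma exists_maximal_irreducible:
  fixes I :: "'k::field mpoly set"
  assumes I: "graded_ideal n I" and irred: "\<And>t. \<not> reducible n I s t"
  obtains Q where "graded_ideal n Q" "I \<subseteq> Q" "\<And>t. \<not> reducible n Q s t"
    "\<And>Q'. graded_ideal n Q' \<Longrightarrow> Q \<subset> Q' \<Longrightarrow> \<exists>t. reducible n Q' s t"
proof -
  define \<A> where "\<A> = {Q. graded_ideal n Q \<and> I \<subseteq> Q \<and> (\<forall>t. \<not> reducible n Q s t)}"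
  have "\<exists>M\<in>\<A>. \<forall>X\<in>\<A>. M \<subseteq> X \<longrightarrow> X = M"
  proof (rule subset_Zorn_nonempty)
    show "\<A> \<noteq> {}"
      using I irred by (auto simp: \<A>_def)
    fix C assume "C \<noteq> {}" and chain: "subset.chain \<A> C"
    have C: "graded_ideal n B" "I \<subseteq> B" "\<not> reducible n B s t" if "B \<in> C" for B t
      using chain that by (auto simp: subset.chain_def \<A>_def)
    have "\<not> reducible n (\<Union>C) s t" for t
    proof
      assume "reducible n (\<Union>C) s t"
      then obtain z where z: "\<And>i. i < s \<Longrightarrow> z i \<in> forms n 1" "forms n t \<subseteq> adjoin n (\<Union>C) s z"
        by (auto simp: reducible_def)
      have "\<forall>a\<in>mons {..<n} t. \<exists>q. q \<in> \<Union>C \<and> monomial a \<in> adjoin n {q} s z"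
      proof
        fix a assume "a \<in> mons {..<n} t"
        then have "(monomial a :: 'k mpoly) \<in> forms n t"
          by (rule forms_monomial)
        with z(2) have "monomial a \<in> adjoin n (\<Union>C) s z" by blast
        then show "\<exists>q. q \<in> \<Union>C \<and> monomial a \<in> adjoin n {q} s z"
          unfolding adjoin_def by blast
      qed
      from bchoice[OF this] obtain q where q: "\<And>a. a \<in> mons {..<n} t \<Longrightarrow> q a \<in> \<Union>C"
        "\<And>a. a \<in> mons {..<n} t \<Longrightarrow> monomial a \<in> adjoin n {q a} s z"
        by blast
      have "q ` mons {..<n} t \<subseteq> \<Union>C" "finite (q ` mons {..<n} t)"
        using q(1) by (auto simp: finite_mons)
      with \<open>C \<noteq> {}\<close> chain obtain B where B: "B \<in> C" "q ` mons {..<n} t \<subseteq> B"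
        by (metis finite_subset_Union_chain)
      have "forms n t \<subseteq> adjoin n B s z"
      proof (rule forms_subset_idealI)
        show "ideal (adjoin n B s z) (mpoly_ring n)"
          using graded_idealD(1)[OF C(1)[OF B(1)]] forms_polys[OF z(1)] by (rule ideal_adjoin)
        fix a assume a: "a \<in> mons {..<n} t"
        then have "{q a} \<subseteq> B" using B(2) by blast
        from adjoin_mono[OF this] q(2)[OF a] show "monomial a \<in> adjoin n B s z" by blast
      qed
      then show False
        using C(3)[OF B(1)] z(1) by (auto simp: reducible_def)
    qed
    moreover have "graded_ideal n (\<Union>C)"
      using chain \<open>C \<noteq> {}\<close> by (intro graded_ideal_Union_chain) (auto simp: subset.chain_def \<A>_def)
    moreover have "I \<subseteq> \<Union>C"
      using C(2) \<open>C \<noteq> {}\<close> by blast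
    ultimately show "\<Union>C \<in> \<A>"
      by (simp add: \<A>_def)
  qed
  then obtain Q where Q: "Q \<in> \<A>" "\<And>X. X \<in> \<A> \<Longrightarrow> Q \<subseteq> X \<Longrightarrow> X = Q" by blast
  show thesis
  proof (rule that[of Q])
    fix Q' assume "graded_ideal n Q'" "Q \<subset> Q'"
    then show "\<exists>t. reducible n Q' s t"
      using Q(1) Q(2)[of Q'] by (auto simp: \<A>_def)
  qed (use Q(1) in \<open>auto simp: \<A>_def\<close>)
qed

lemma mons_split:
  assumes "a \<in> mons S (t + u)"
  shows "\<exists>b\<in>mons S t. \<exists>c\<in>mons S u. a = b + c"
  using assms
proof (induction t arbitrary: a)
  case (Suc t)
  then have "a \<in> mons S (Suc (t + u))" by simp
  then obtain i a' where a': "i \<in> S" "a' \<in> mons S (t + u)" "a = Poly_Mapping.single i 1 + a'"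
    by (rule mons_SucE)
  obtain b c where "b \<in> mons S t" "c \<in> mons S u" "a' = b + c"
    using Suc.IH[OF a'(2)] by blast
  moreover from this have "Poly_Mapping.single i 1 + b \<in> mons S (Suc t)"
    using mons_add[OF mons_single[OF a'(1), of 1], of b t] by (simp flip: Suc_eq_plus1_left)
  ultimately show ?case
    using a'(3) by (metis add.assoc)
qed simp

text \<open>If \<open>f g \<in> Q\<close>, then linear forms generating both \<open>R/(Q + f)\<close> and \<open>R/(Q + g)\<close> in large degrees also
  generate \<open>R/Q\<close> in large degrees.  Such common linear forms exist by genericity.\<close>

lemma maximal_irreducible_prime:
  fixes Q :: "'k::field mpoly set"
  assumes k: "infinite (UNIV :: 'k set)" and Q: "graded_ideal n Q" and irred: "\<And>t. \<not> reducible n Q s t"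
    and max: "\<And>Q'. graded_ideal n Q' \<Longrightarrow> Q \<subset> Q' \<Longrightarrow> \<exists>t. reducible n Q' s t"
  shows "primeideal Q (mpoly_ring n)"
proof (rule graded_primeI[OF Q])
  note Q' = graded_idealD(1)[OF Q]
  show "Q \<noteq> polys n"
  proof
    assume "Q = polys n"
    then have "forms n 0 \<subseteq> adjoin n Q s (\<lambda>_. 0)"
      using forms_polys subset_adjoin by blast
    then show False
      using irred[of 0] reducibleI[of s "\<lambda>_. 0" n 0 Q] by simp
  qed
  fix d e and f g :: "'k mpoly"
  assume f: "f \<in> forms n d" and g: "g \<in> forms n e" and fg: "f * g \<in> Q"
  show "f \<in> Q \<or> g \<in> Q"
  proof (rule ccontr)
    assume "\<not> ?thesis"
    then have notin: "f \<notin> Q" "g \<notin> Q" by auto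
    have ex: "\<exists>t. reducible n (adjoin n Q 1 (\<lambda>_. h)) s t" if "h \<in> forms n c" "h \<notin> Q" for h c
    proof (rule max)
      show "graded_ideal n (adjoin n Q 1 (\<lambda>_. h))"
        using Q that(1) by (rule graded_adjoin_forms)
      have "h \<in> adjoin n Q 1 (\<lambda>_. h)"
        using generator_in_adjoin[OF ideal_mpolyD(2)[OF Q'], of 0 1 "\<lambda>_. h"] by simp
      then show "Q \<subset> adjoin n Q 1 (\<lambda>_. h)"
        using subset_adjoin[of Q n 1 "\<lambda>_. h"] that(2) by blast
    qed
    obtain t u where red: "reducible n (adjoin n Q 1 (\<lambda>_. f)) s t" "reducible n (adjoin n Q 1 (\<lambda>_. g)) s u"
      using ex[OF f notin(1)] ex[OF g notin(2)] by blast
    let ?h = "\<lambda>b::bool. if b then f else g" and ?t = "\<lambda>b::bool. if b then t else u"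
    have "graded_ideal n (adjoin n Q 1 (\<lambda>_. ?h b))" for b
      using graded_adjoin_forms[OF Q f] graded_adjoin_forms[OF Q g] by (cases b) auto
    moreover have "reducible n (adjoin n Q 1 (\<lambda>_. ?h b)) s (?t b)" for b
      using red by simp
    ultimately obtain z where z: "\<And>i. i < s \<Longrightarrow> z i \<in> forms n 1"
      "\<And>b. forms n (?t b) \<subseteq> adjoin n (adjoin n Q 1 (\<lambda>_. ?h b)) s z"
      using common_reduction[OF k, of "UNIV :: bool set" n "\<lambda>b. adjoin n Q 1 (\<lambda>_. ?h b)" s ?t] by auto
    have A: "ideal (adjoin n Q s z) (mpoly_ring n)"
      using Q' forms_polys[OF z(1)] by (rule ideal_adjoin)
    have cofactor: "\<exists>r\<in>polys n. p - ?h b * r \<in> adjoin n Q s z" if p: "p \<in> forms n (?t b)" for p b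
    proof -
      have "p \<in> adjoin n (adjoin n Q 1 (\<lambda>_. ?h b)) s z"
        using z(2) p by blast
      then obtain q1 y where q1: "q1 \<in> adjoin n Q 1 (\<lambda>_. ?h b)" "\<And>i. i < s \<Longrightarrow> y i \<in> polys n"
        "p = q1 + (\<Sum>i<s. z i * y i)"
        by (rule adjoinE) (rule that, assumption+)
      from adjoin_singleE[OF q1(1)] obtain q r where q: "q \<in> Q" "r \<in> polys n" "q1 = q + ?h b * r"
        by (elim bexE)
      have "p - ?h b * r = q + (\<Sum>i<s. z i * y i)"
        unfolding q1(3) q(3) by simp
      also have "\<dots> \<in> adjoin n Q s z"
        using q(1) q1(2) by (rule adjoinI)
      finally show ?thesis
        using q(2) by blast
    qed
    have "forms n (t + u) \<subseteq> adjoin n Q s z"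
    proof (rule forms_subset_idealI[OF A])
      fix a assume "a \<in> mons {..<n} (t + u)"
      then obtain b c where bc: "b \<in> mons {..<n} t" "c \<in> mons {..<n} u" "a = b + c"
        using mons_split by blast
      let ?b = "monomial b :: 'k mpoly" and ?c = "monomial c :: 'k mpoly"
      obtain r where r: "r \<in> polys n" "?b - f * r \<in> adjoin n Q s z"
        using cofactor[of ?b True] forms_monomial[OF bc(1)] by auto
      obtain v where v: "v \<in> polys n" "?c - g * v \<in> adjoin n Q s z"
        using cofactor[of ?c False] forms_monomial[OF bc(2)] by auto
      \<comment> \<open>Modulo \<open>Q + (z)\<close> the two factors are multiples of \<open>f\<close> and of \<open>g\<close>.\<close>
      have "f * g \<in> adjoin n Q s z"
        using fg subset_adjoin by blast
      then have "(?b - f * r) * ?c + (f * r) * (?c - g * v) + (f * g) * (r * v) \<in> adjoin n Q s z"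
        using ideal_mpolyD(5)[OF A r(2) polys_monomial[OF mons_expos[OF bc(2)]]]
          ideal_mpolyD(4)[OF A v(2) polys_mult[OF forms_polys[OF f] r(1)]]
          ideal_mpolyD(5)[OF A _ polys_mult[OF r(1) v(1)]]
        by (intro ideal_mpolyD(3)[OF A])
      moreover have "(?b - f * r) * ?c + (f * r) * (?c - g * v) + (f * g) * (r * v) = monomial a"
        unfolding bc(3) monomial_add by (simp add: algebra_simps)
      ultimately show "monomial a \<in> adjoin n Q s z" by simp
    qed
    then show False
      using irred[of "t + u"] reducibleI[of s z n "t + u" Q] z(1) by blast
  qed
qed

definition irrelevant_ideal :: "nat \<Rightarrow> 'k::field mpoly set" where
  "irrelevant_ideal n = {p \<in> polys n. Poly_Mapping.lookup p 0 = 0}"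

lemma lookup_mult_0:
  fixes p q :: "'k::field mpoly"
  shows "Poly_Mapping.lookup (p * q) 0 = Poly_Mapping.lookup p 0 * Poly_Mapping.lookup q 0"
proof -
  let ?c = "Poly_Mapping.lookup p 0"
  define r where "r = p - mpoly_scale ?c 1"
  have r0: "0 \<notin> Poly_Mapping.keys r"
    by (simp add: r_def in_keys_iff lookup_minus)
  have "0 \<notin> Poly_Mapping.keys (r * q)"
  proof
    assume "0 \<in> Poly_Mapping.keys (r * q)"
    then obtain a b where ab: "a \<in> Poly_Mapping.keys r" "0 = a + b"
      using Poly_Mapping.keys_mult[of r q] by blast
    have "expo_deg a = 0"
      using expo_deg_add[of a b] by (simp flip: ab(2))
    with ab(1) r0 show False
      by (simp add: expo_deg_0_iff)
  qed
  moreover have "p * q = mpoly_scale ?c q + r * q"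
    by (simp add: r_def left_diff_distrib scale_mult_left)
  ultimately show ?thesis
    by (simp add: lookup_add in_keys_iff)
qed

lemma irrelevant_ideal_prime: "primeideal (irrelevant_ideal n :: 'k::field mpoly set) (mpoly_ring n)"
proof (rule primeidealI)
  show "ideal (irrelevant_ideal n :: 'k mpoly set) (mpoly_ring n)"
    unfolding ideal_mpoly_iff
    by (auto simp: irrelevant_ideal_def polys_add polys_mult lookup_add lookup_mult_0)
  have "1 \<notin> (irrelevant_ideal n :: 'k mpoly set)"
    by (simp add: irrelevant_ideal_def)
  then show "polys n \<noteq> (irrelevant_ideal n :: 'k mpoly set)"
    using polys_1 by blast
qed (auto simp: irrelevant_ideal_def lookup_mult_0 cring_mpoly_ring)

lemma proper_subset_irrelevant:
  fixes Q :: "'k::field mpoly set"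
  assumes Q: "graded_ideal n Q" and proper: "Q \<noteq> polys n"
  shows "Q \<subseteq> irrelevant_ideal n"
proof
  fix p assume p: "p \<in> Q"
  note Q' = graded_idealD(1)[OF Q]
  let ?c = "Poly_Mapping.lookup p 0"
  have "?c = 0"
  proof (rule ccontr)
    assume "?c \<noteq> 0"
    have "part 0 p = mpoly_scale ?c 1"
      by (rule poly_mapping_eqI) (auto simp: lookup_part expo_deg_0_iff lookup_one)
    then have "1 = mpoly_scale (inverse ?c) (part 0 p)"
      using \<open>?c \<noteq> 0\<close> by simp
    also have "\<dots> \<in> Q"
      using p by (intro ideal_mpolyD(6)[OF Q'] graded_idealD(2)[OF Q])
    finally have "r \<in> Q" if "r \<in> polys n" for r
      using ideal_mpolyD(4)[OF Q' _ that, of 1] by simp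
    with proper ideal_mpolyD(1)[OF Q'] show False by blast
  qed
  with p show "p \<in> irrelevant_ideal n"
    using ideal_mpolyD(1)[OF Q'] by (auto simp: irrelevant_ideal_def)
qed

text \<open>If no \<open>s\<close> linear forms suffice in any degree, the same holds for a prime ideal \<open>Q\<close> above \<open>I\<close>.  After adjoining to
  \<open>Q\<close> a linear form outside of it, no \<open>s - 1\<close> linear forms suffice, and so on.  The last member of the
  chain is the irrelevant ideal.\<close>

lemma irreducible_imp_prime_chain:
  fixes I :: "'k::field mpoly set"
  assumes k: "infinite (UNIV :: 'k set)" and "graded_ideal n I" "\<And>t. \<not> reducible n I s t"
  shows "\<exists>P. I \<subseteq> P 0 \<and> (\<forall>i\<le>Suc s. primeideal (P i) (mpoly_ring n)) \<and> (\<forall>i<Suc s. P i \<subset> P (Suc i))"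
  using assms(2,3)
proof (induction s arbitrary: I)
  case 0
  obtain Q where Q: "graded_ideal n Q" "I \<subseteq> Q"
    "\<And>t. \<not> reducible n Q 0 t" "\<And>Q'. graded_ideal n Q' \<Longrightarrow> Q \<subset> Q' \<Longrightarrow> \<exists>t. reducible n Q' 0 t"
    by (rule exists_maximal_irreducible[OF 0]) (rule that, assumption+)
  have prime: "primeideal Q (mpoly_ring n)"
    by (rule maximal_irreducible_prime[OF k Q(1,3,4)])
  have sub: "Q \<subseteq> irrelevant_ideal n"
    using primeideal.I_notcarr[OF prime] by (intro proper_subset_irrelevant[OF Q(1)]) simp
  have "Q \<noteq> irrelevant_ideal n"
  proof
    assume *: "Q = irrelevant_ideal n"
    have "forms n 1 \<subseteq> irrelevant_ideal n"
      by (auto simp: irrelevant_ideal_def forms_def in_keys_iff dest!: bspec[of _ _ 0])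
    then have "forms n 1 \<subseteq> adjoin n Q 0 (\<lambda>_. 0)"
      using * subset_adjoin by blast
    then show False
      using Q(3)[of 1] reducibleI[of 0 "\<lambda>_. 0" n 1 Q] by simp
  qed
  then show ?case
    using prime Q(2) sub irrelevant_ideal_prime
    by (intro exI[of _ "\<lambda>i. if i = 0 then Q else irrelevant_ideal n"]) auto
next
  case (Suc s)
  obtain Q where Q: "graded_ideal n Q" "I \<subseteq> Q"
    "\<And>t. \<not> reducible n Q (Suc s) t"
    "\<And>Q'. graded_ideal n Q' \<Longrightarrow> Q \<subset> Q' \<Longrightarrow> \<exists>t. reducible n Q' (Suc s) t"
    by (rule exists_maximal_irreducible[OF Suc.prems]) (rule that, assumption+)
  note Q' = graded_idealD(1)[OF Q(1)]
  have prime: "primeideal Q (mpoly_ring n)"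
    by (rule maximal_irreducible_prime[OF k Q(1,3,4)])
  have "\<exists>x\<in>forms n 1. x \<notin> Q"
  proof (rule ccontr)
    assume "\<not> ?thesis"
    then have "forms n 1 \<subseteq> adjoin n Q (Suc s) (\<lambda>_. 0)"
      using subset_adjoin by blast
    then show False
      using Q(3)[of 1] reducibleI[of "Suc s" "\<lambda>_. 0" n 1 Q] by simp
  qed
  then obtain x where x: "x \<in> forms n 1" "x \<notin> Q" by blast
  let ?Q = "adjoin n Q 1 (\<lambda>_. x)"
  have "graded_ideal n ?Q"
    using Q(1) x(1) by (rule graded_adjoin_forms)
  moreover have "\<not> reducible n ?Q s t" for t
    using reducible_adjoin[OF Q' x(1)] Q(3) by blast
  ultimately have "\<exists>P. ?Q \<subseteq> P 0 \<and> (\<forall>i\<le>Suc s. primeideal (P i) (mpoly_ring n)) \<and>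
      (\<forall>i<Suc s. P i \<subset> P (Suc i))"
    by (rule Suc.IH)
  then obtain P where P: "?Q \<subseteq> P 0" "\<forall>i\<le>Suc s. primeideal (P i) (mpoly_ring n)"
    "\<forall>i<Suc s. P i \<subset> P (Suc i)"
    by (elim exE conjE)
  have "x \<in> ?Q"
    using generator_in_adjoin[OF ideal_mpolyD(2)[OF Q'], of 0 1 "\<lambda>_. x"] by simp
  then have "Q \<subset> P 0"
    using subset_adjoin[of Q n 1 "\<lambda>_. x"] P(1) x(2) by blast
  then show ?case
    using P(2,3) prime Q(2)
    by (intro exI[of _ "\<lambda>i. case i of 0 \<Rightarrow> Q | Suc l \<Rightarrow> P l"]) (auto split: nat.split)
qed

section \<open>Reductions of the quotient ring\<close>

lemma (in ring) coset_mem_image_iff: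
  assumes "ideal I R" "ideal J R" "I \<subseteq> J" "a \<in> carrier R"
  shows "I +> a \<in> (+>) I ` J \<longleftrightarrow> a \<in> J"
proof -
  have J: "(+>) I ` J \<subseteq> carrier (R Quot I)"
    using ring_ideal_imp_quot_ideal[OF assms(1,2)]
    by (simp add: additive_subgroup.a_subset ideal_def)
  have "\<Union> ((+>) I ` J) = J"
    using ideal_incl_iff[OF assms(1,2)] assms(3) by simp
  then show ?thesis
    using canonical_proj_vimage_mem_iff[OF assms(1) J assms(4)] by simp
qed

lemma (in cring) primeideal_Quot:
  assumes I: "ideal I R" and P: "primeideal P R" and "I \<subseteq> P"
  shows "primeideal ((+>) I ` P) (R Quot I)"
proof (rule primeidealI)
  have P': "ideal P R"
    using P by (simp add: primeideal_def)
  show "ideal ((+>) I ` P) (R Quot I)"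
    using I P' by (rule ring_ideal_imp_quot_ideal)
  show "cring (R Quot I)"
    using I is_cring by (rule ideal.quotient_is_cring)
  note mem = coset_mem_image_iff[OF I P' \<open>I \<subseteq> P\<close>]
  have carr: "carrier (R Quot I) = (+>) I ` carrier R"
    by (auto simp: FactRing_def A_RCOSETS_def')
  show "carrier (R Quot I) \<noteq> (+>) I ` P"
  proof
    assume eq: "carrier (R Quot I) = (+>) I ` P"
    have "a \<in> P" if a: "a \<in> carrier R" for a
    proof -
      have "I +> a \<in> carrier (R Quot I)"
        unfolding carr using a by (rule imageI)
      then show ?thesis
        using mem[OF a] by (simp add: eq)
    qed
    then have "carrier R = P"
      using ideal.Icarr[OF P'] by (intro subset_antisym subsetI)
    then show False
      using primeideal.I_notcarr[OF P] by simp
  qed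
  fix X Y assume X: "X \<in> carrier (R Quot I)" "Y \<in> carrier (R Quot I)" "X \<otimes>\<^bsub>R Quot I\<^esub> Y \<in> (+>) I ` P"
  then obtain a b where ab: "a \<in> carrier R" "X = I +> a" "b \<in> carrier R" "Y = I +> b"
    unfolding carr by blast
  have "X \<otimes>\<^bsub>R Quot I\<^esub> Y = I +> (a \<otimes> b)"
    using ring_hom_mult[OF ideal.rcos_ring_hom[OF I]] ab by simp
  with X(3) ab show "X \<in> (+>) I ` P \<or> Y \<in> (+>) I ` P"
    using mem primeideal.I_prime[OF P ab(1,3)] by auto
qed

lemma reducible_if_krull_dim_le:
  fixes I :: "'k::field mpoly set"
  assumes k: "infinite (UNIV :: 'k set)" and I: "graded_ideal n I"
    and dim: "krull_dim (mpoly_ring n Quot I) \<le> enat s"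
  shows "\<exists>t. reducible n I s t"
proof (rule ccontr)
  assume "\<nexists>t. reducible n I s t"
  then have irred: "\<And>t. \<not> reducible n I s t" by simp
  from irreducible_imp_prime_chain[OF k I irred] obtain P where "I \<subseteq> P 0"
    "\<forall>i\<le>Suc s. primeideal (P i) (mpoly_ring n)" "\<forall>i<Suc s. P i \<subset> P (Suc i)"
    by (elim exE conjE)
  then have P: "I \<subseteq> P 0" "\<And>i. i \<le> Suc s \<Longrightarrow> primeideal (P i) (mpoly_ring n)"
    "\<And>i. i < Suc s \<Longrightarrow> P i \<subset> P (Suc i)"
    by simp_all
  interpret R: cring "mpoly_ring n :: 'k mpoly ring" by (rule cring_mpoly_ring)
  note I' = graded_idealD(1)[OF I]
  have sub: "I \<subseteq> P i" if "i \<le> Suc s" for i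
    using that by (induction i) (use P(1,3) in \<open>auto simp: Suc_le_eq\<close>)
  let ?\<pi> = "(+>\<^bsub>mpoly_ring n\<^esub>) I"
  have PI: "ideal (P i) (mpoly_ring n)" if "i \<le> Suc s" for i
    using P(2)[OF that] by (simp add: primeideal_def)
  have pr: "primeideal (?\<pi> ` P i) (mpoly_ring n Quot I)" if "i \<le> Suc s" for i
    using I' P(2)[OF that] sub[OF that] by (rule R.primeideal_Quot)
  have sm: "?\<pi> ` P i \<subset> ?\<pi> ` P (Suc i)" if i: "i < Suc s" for i
  proof -
    obtain p where p: "p \<in> P (Suc i)" "p \<notin> P i"
      using P(3)[OF i] by blast
    have "?\<pi> p \<notin> ?\<pi> ` P i"
      using R.coset_mem_image_iff[OF I' PI sub, of i p] p i ideal.Icarr[OF PI, of "Suc i" p] by simp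
    with p P(3)[OF i] show ?thesis by blast
  qed
  have "enat (Suc s) \<le> krull_dim (mpoly_ring n Quot I)"
    unfolding krull_dim_def
    by (intro Sup_upper CollectI exI[of _ "Suc s"] conjI refl exI[of _ "\<lambda>i. ?\<pi> ` P i"] allI impI pr sm)
  from order_trans[OF this dim] show False by simp
qed

text \<open>The bridge between ideals of \<open>R/I\<close> and ideals of \<open>R\<close> that contain \<open>I\<close>.\<close>

lemma quot_forms_subset_iff:
  fixes I :: "'k::field mpoly set"
  assumes I: "ideal I (mpoly_ring n)" and w: "\<And>i. i < s \<Longrightarrow> w i \<in> polys n"
  defines "\<qq> \<equiv> genideal (mpoly_ring n Quot I) ((\<lambda>i. I +>\<^bsub>mpoly_ring n\<^esub> w i) ` {..<s})"
  shows "\<qq> \<inter> quot_forms n I t = quot_forms n I t \<longleftrightarrow> forms n t \<subseteq> adjoin n I s w"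
proof -
  interpret R: cring "mpoly_ring n :: 'k mpoly ring" by (rule cring_mpoly_ring)
  interpret I: ideal I "mpoly_ring n" by (rule I)
  interpret Q: ring "mpoly_ring n Quot I" using I by (rule ideal.quotient_is_ring)
  interpret h: ring_hom_ring "mpoly_ring n" "mpoly_ring n Quot I" "(+>\<^bsub>mpoly_ring n\<^esub>) I"
    using I by (rule ideal.rcos_ring_hom_ring)
  let ?\<pi> = "(+>\<^bsub>mpoly_ring n\<^esub>) I"
  have A: "ideal (adjoin n I s w) (mpoly_ring n)"
    using I w by (rule ideal_adjoin)
  have gens: "(\<lambda>i. ?\<pi> (w i)) ` {..<s} \<subseteq> carrier (mpoly_ring n Quot I)"
    using w h.hom_closed by blast
  have mem: "?\<pi> p \<in> \<qq> \<longleftrightarrow> p \<in> adjoin n I s w" if p: "p \<in> polys n" for p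
  proof
    have "\<qq> \<subseteq> ?\<pi> ` adjoin n I s w"
      unfolding \<qq>_def
    proof (rule Q.genideal_minimal)
      show "ideal (?\<pi> ` adjoin n I s w) (mpoly_ring n Quot I)"
        using I A by (rule R.ring_ideal_imp_quot_ideal)
      show "(\<lambda>i. ?\<pi> (w i)) ` {..<s} \<subseteq> ?\<pi> ` adjoin n I s w"
        using generator_in_adjoin[OF ideal_mpolyD(2)[OF I]] by blast
    qed
    then show "p \<in> adjoin n I s w" if "?\<pi> p \<in> \<qq>"
      using that R.coset_mem_image_iff[OF I A subset_adjoin p] by blast
    have "ideal {r \<in> polys n. ?\<pi> r \<in> \<qq>} (mpoly_ring n)"
      unfolding \<qq>_def using gens by (intro h.ideal_vimage Q.genideal_ideal)
    moreover have "I \<subseteq> {r \<in> polys n. ?\<pi> r \<in> \<qq>}"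
    proof
      fix r assume r: "r \<in> I"
      have "?\<pi> r = \<zero>\<^bsub>mpoly_ring n Quot I\<^esub>"
        using I.a_rcos_const[OF r] by (simp add: FactRing_def)
      moreover have "\<zero>\<^bsub>mpoly_ring n Quot I\<^esub> \<in> \<qq>"
        unfolding \<qq>_def using Q.genideal_ideal[OF gens]
        by (simp add: additive_subgroup.zero_closed ideal_def)
      ultimately show "r \<in> {r \<in> polys n. ?\<pi> r \<in> \<qq>}"
        using r ideal_mpolyD(1)[OF I] by auto
    qed
    moreover have "w i \<in> {r \<in> polys n. ?\<pi> r \<in> \<qq>}" if "i < s" for i
      using Q.genideal_self[OF gens] w that by (auto simp: \<qq>_def)
    ultimately have "adjoin n I s w \<subseteq> {r \<in> polys n. ?\<pi> r \<in> \<qq>}"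
      by (rule adjoin_minimal)
    then show "?\<pi> p \<in> \<qq>" if "p \<in> adjoin n I s w"
      using that by blast
  qed
  have "\<qq> \<inter> quot_forms n I t = quot_forms n I t \<longleftrightarrow> (\<forall>p\<in>forms n t. ?\<pi> p \<in> \<qq>)"
    unfolding Int_absorb2[symmetric] by (auto simp: quot_forms_def)
  also have "\<dots> \<longleftrightarrow> (\<forall>p\<in>forms n t. p \<in> adjoin n I s w)"
    by (intro ball_cong refl mem forms_polys)
  finally show ?thesis
    unfolding subset_eq .
qed

lemma s_reduction_iff:
  fixes I :: "'k::field mpoly set"
  assumes I: "ideal I (mpoly_ring n)"
  shows "s_reduction (mpoly_ring n Quot I) (quot_forms n I) s \<qq> \<longleftrightarrow>
    (\<exists>w. (\<forall>i<s. w i \<in> forms n 1) \<and>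
      \<qq> = genideal (mpoly_ring n Quot I) ((\<lambda>i. I +>\<^bsub>mpoly_ring n\<^esub> w i) ` {..<s}) \<and>
      (\<exists>t. forms n t \<subseteq> adjoin n I s w))" (is "?L \<longleftrightarrow> ?R")
proof
  assume ?L
  then obtain z t0 where z: "\<forall>i<s. z i \<in> quot_forms n I 1"
    "\<qq> = genideal (mpoly_ring n Quot I) (z ` {..<s})"
    "\<And>t. t \<ge> t0 \<Longrightarrow> \<qq> \<inter> quot_forms n I t = quot_forms n I t"
    by (auto simp: s_reduction_def)
  have "\<forall>i\<in>{..<s}. \<exists>w. w \<in> forms n 1 \<and> z i = I +>\<^bsub>mpoly_ring n\<^esub> w"
    using z(1) by (auto simp: quot_forms_def)
  from bchoice[OF this] obtain w where w: "\<And>i. i < s \<Longrightarrow> w i \<in> forms n 1"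
    "\<And>i. i < s \<Longrightarrow> z i = I +>\<^bsub>mpoly_ring n\<^esub> w i"
    by blast
  have "z ` {..<s} = (\<lambda>i. I +>\<^bsub>mpoly_ring n\<^esub> w i) ` {..<s}"
    using w(2) by (intro image_cong) auto
  with z(2) have \<qq>: "\<qq> = genideal (mpoly_ring n Quot I) ((\<lambda>i. I +>\<^bsub>mpoly_ring n\<^esub> w i) ` {..<s})"
    by simp
  have "forms n t0 \<subseteq> adjoin n I s w"
    using quot_forms_subset_iff[of I n s w t0, OF I forms_polys[OF w(1)]] z(3)[of t0] \<qq> by simp
  with w(1) \<qq> show ?R by blast
next
  assume ?R
  then obtain w t where w: "\<And>i. i < s \<Longrightarrow> w i \<in> forms n 1" "forms n t \<subseteq> adjoin n I s w"
    and \<qq>: "\<qq> = genideal (mpoly_ring n Quot I) ((\<lambda>i. I +>\<^bsub>mpoly_ring n\<^esub> w i) ` {..<s})"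
    by blast
  have "\<qq> \<inter> quot_forms n I u = quot_forms n I u" if "u \<ge> t" for u
    unfolding \<qq> using quot_forms_subset_iff[of I n s w u, OF I forms_polys[OF w(1)]]
      forms_subset_ideal_mono[OF ideal_adjoin[OF I forms_polys[OF w(1)]] w(2) that] by simp
  then show ?L
    unfolding s_reduction_def using w(1) \<qq>
    by (auto simp: quot_forms_def intro!: exI[of _ "\<lambda>i. I +>\<^bsub>mpoly_ring n\<^esub> w i"])
qed

lemma s_reduction_number_le:
  fixes I :: "'k::field mpoly set"
  assumes I: "ideal I (mpoly_ring n)" and red: "reducible n I s (r + 1)"
  shows "s_reduction_number (mpoly_ring n Quot I) (quot_forms n I) s \<le> r"
proof -
  obtain w where w: "\<And>i. i < s \<Longrightarrow> w i \<in> forms n 1" "forms n (r + 1) \<subseteq> adjoin n I s w"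
    using red by (auto simp: reducible_def)
  define \<qq> where "\<qq> = genideal (mpoly_ring n Quot I) ((\<lambda>i. I +>\<^bsub>mpoly_ring n\<^esub> w i) ` {..<s})"
  have "s_reduction (mpoly_ring n Quot I) (quot_forms n I) s \<qq>"
    unfolding s_reduction_iff[OF I] using w \<qq>_def by blast
  then have "s_reduction_number (mpoly_ring n Quot I) (quot_forms n I) s
      \<le> reduction_number_of (quot_forms n I) \<qq>"
    unfolding s_reduction_number_def by (intro Least_le) blast
  also have "\<dots> \<le> r"
    unfolding reduction_number_of_def \<qq>_def
    using w by (intro Least_le) (simp add: quot_forms_subset_iff[OF I forms_polys[OF w(1)]])
  finally show ?thesis .
qed

lemma reducible_s_reduction_number:
  fixes I :: "'k::field mpoly set"
  assumes I: "ideal I (mpoly_ring n)" and red: "reducible n I s t"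
  shows "reducible n I s (s_reduction_number (mpoly_ring n Quot I) (quot_forms n I) s + 1)"
proof -
  let ?r = "s_reduction_number (mpoly_ring n Quot I) (quot_forms n I) s"
  let ?P = "\<lambda>r. \<exists>\<qq>. s_reduction (mpoly_ring n Quot I) (quot_forms n I) s \<qq> \<and>
      r = reduction_number_of (quot_forms n I) \<qq>"
  have "\<exists>\<qq>. s_reduction (mpoly_ring n Quot I) (quot_forms n I) s \<qq>"
    unfolding s_reduction_iff[OF I] using red unfolding reducible_def by blast
  then have "?P ?r"
    unfolding s_reduction_number_def by (intro LeastI_ex[of ?P]) blast
  then obtain w u where w: "\<And>i. i < s \<Longrightarrow> w i \<in> forms n 1" "forms n u \<subseteq> adjoin n I s w"
    and r: "?r = reduction_number_of (quot_forms n I)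
      (genideal (mpoly_ring n Quot I) ((\<lambda>i. I +>\<^bsub>mpoly_ring n\<^esub> w i) ` {..<s}))"
    unfolding s_reduction_iff[OF I] by blast
  have r': "?r = (LEAST r. forms n (r + 1) \<subseteq> adjoin n I s w)"
    unfolding r reduction_number_of_def
    by (simp add: quot_forms_subset_iff[OF I forms_polys[OF w(1)]])
  have "forms n (u + 1) \<subseteq> adjoin n I s w"
    by (rule forms_subset_ideal_mono[OF ideal_adjoin[OF I forms_polys[OF w(1)]] w(2)]) simp_all
  then have "forms n (?r + 1) \<subseteq> adjoin n I s w"
    unfolding r' by (rule LeastI)
  with w(1) show ?thesis
    by (auto simp: reducible_def)
qed

lemma reducible_by_all_variables:
  fixes I :: "'k::field mpoly set"
  assumes I: "ideal I (mpoly_ring n)" and "n \<le> s"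
  shows "reducible n I s 1"
proof -
  let ?z = "\<lambda>i. if i < n then monomial (Poly_Mapping.single i 1) else 0 :: 'k mpoly"
  have z: "?z i \<in> forms n 1" for i
    by (auto intro: forms_monomial mons_single)
  have "forms n 1 \<subseteq> adjoin n I s ?z"
  proof (rule forms_subset_idealI)
    show "ideal (adjoin n I s ?z) (mpoly_ring n)"
      using I forms_polys[OF z] by (rule ideal_adjoin)
    fix a assume "a \<in> mons {..<n} 1"
    then have "a \<in> mons {..<n} (Suc 0)" by (simp add: One_nat_def)
    then obtain i where "i < n" "a = Poly_Mapping.single i 1"
      by (rule mons_SucE) simp
    then show "monomial a \<in> adjoin n I s ?z"
      using generator_in_adjoin[of I i s ?z n, OF ideal_mpolyD(2)[OF I]] \<open>n \<le> s\<close> by simp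
  qed
  with z show ?thesis
    by (rule reducibleI)
qed

theorem corollary2p5:
  fixes n s :: nat and I J :: "'k::field mpoly set"
  assumes "infinite (UNIV :: 'k set)"
    and "homogeneous_ideal n I"
    and "I \<noteq> carrier (mpoly_ring n)"
    and "krull_dim (mpoly_ring n Quot I) \<le> enat s"
    and "is_lex_ideal_of n J I"
  shows "s_reduction_number (mpoly_ring n Quot I) (quot_forms n I) s
    \<le> s_reduction_number (mpoly_ring n Quot J) (quot_forms n J) s"
proof (cases "s < n")
  case False
  have "ideal I (mpoly_ring n)"
    using homogeneous_imp_graded[OF assms(2)] by (rule graded_idealD)
  with False have "s_reduction_number (mpoly_ring n Quot I) (quot_forms n I) s \<le> 0"
    by (intro s_reduction_number_le) (simp_all add: reducible_by_all_variables)
  then show ?thesis by simp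
next
  case True
  have lex: "lex_segment_ideal n J" and hilb: "hilbert_function n J = hilbert_function n I"
    using assms(5) by (auto simp: is_lex_ideal_of_def)
  have I: "graded_ideal n I"
    by (rule homogeneous_imp_graded[OF assms(2)])
  have J: "graded_ideal n J"
    using lex by (intro homogeneous_imp_graded monomial_ideal_homogeneous) (simp add: lex_segment_ideal_def)
  have large: "reducible n L s t"
    if "graded_ideal n L" "mon_count n t < hilbert_function n L t + mon_count (Suc s) t"
    for L :: "'k mpoly set" and t
    using that by (intro eakin_sathaye[OF assms(1)] codim_less_hilbert_functionI graded_idealD(1))
  obtain t where "reducible n I s t"
    using reducible_if_krull_dim_le[OF assms(1) I assms(4)] by blast
  from reducible_imp_hilbert_function_large[OF I this]
  obtain u where "mon_count n u < hilbert_function n J u + mon_count (Suc s) u"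
    by (auto simp: hilb)
  then have "reducible n J s u"
    by (rule large[OF J])
  then have "reducible n J s (s_reduction_number (mpoly_ring n Quot J) (quot_forms n J) s + 1)"
    by (rule reducible_s_reduction_number[OF graded_idealD(1)[OF J]])
  from lex_segment_reducible_imp_large[OF lex True this]
  have "reducible n I s (s_reduction_number (mpoly_ring n Quot J) (quot_forms n J) s + 1)"
    unfolding hilb by (rule large[OF I])
  then show ?thesis
    by (rule s_reduction_number_le[OF graded_idealD(1)[OF I]])
qed

end
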